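(* Let $(M,\varphi,\xi,\eta,g,\varepsilon)$ be a $3$-dimensional $(\varepsilon)$-para Sasakian manifold with scalar curvature $r$. Then $M$ is an indefinite space form if and only if $r=-6\varepsilon$.
   Context: All manifolds and tensor fields are smooth; $\mathfrak X(M)$ denotes the vector fields on $M$. An almost paracontact structure $(\varphi,\xi,\eta)$ on $M$ consists of a $(1,1)$-tensor field $\varphi$, a vector field $\xi$ and a $1$-form $\eta$ with $\varphi^2=I-\eta\otimes\xi$, $\eta(\xi)=1$, $\varphi\xi=0$, $\eta\circ\varphi=0$. A semi-Riemannian metric is a non-degenerate symmetric $(0,2)$-tensor field (of some constant index, arbitrary). If $g$ is a semi-Riemannian metric on $M$ with $g(\varphi X,\varphi Y)=g(X,Y)-\varepsilon\eta(X)\eta(Y)$ for all $X,Y\in\mathfrak X(M)$, where $\varepsilon\in\{1,-1\}$ is a constant, then $(M,\varphi,\xi,\eta,g,\varepsilon)$ is an $(\varepsilon)$-almost paracontact metric manifold. It is an $(\varepsilon)$-para Sasakian manifold if moreover $(\nabla_X\varphi)Y=-g(\varphi X,\varphi Y)\xi-\varepsilon\eta(Y)\varphi^2X$ for all $X,Y\in\mathfrak X(M)$, where $\nabla$ is the Levi-Civita connection of $g$. Curvature conventions: $R(X,Y)Z=\nabla_X\nabla_YZ-\nabla_Y\nabla_XZ-\nabla_{[X,Y]}Z$, the Ricci tensor is $S(Y,Z)=\mathrm{trace}(X\mapsto R(X,Y)Z)$, the Ricci operator $Q$ is defined by $g(QX,Y)=S(X,Y)$, and $r=\mathrm{trace}\,Q$.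 $M$ is an indefinite space form if it has constant curvature, i.e. there is a constant $c\in\mathbb R$ with $R(X,Y)Z=c\{g(Y,Z)X-g(X,Z)Y\}$ for all $X,Y,Z\in\mathfrak X(M)$. *)

theory Defs
  imports "HOL-Analysis.Analysis" "HOL-Library.Function_Algebras"
begin

section \<open>Function spaces as real vector spaces\<close>

instantiation "fun" :: (type, real_vector) real_vector
begin

definition scaleR_fun :: "real \<Rightarrow> ('a \<Rightarrow> 'b) \<Rightarrow> 'a \<Rightarrow> 'b"
  where "scaleR_fun c f = (\<lambda>x. c *\<^sub>R f x)"

instance
  by standard (simp_all add: scaleR_fun_def fun_eq_iff scaleR_add_right scaleR_add_left)

end


section \<open>Smooth manifolds\<close>

text \<open>Only used for open \<^term>\<open>S\<close>, where the Frechet derivative is unambiguous. As the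
  domain is finite-dimensional, having all directional derivatives of class \<open>C\<^sup>k\<close> is the same as
  the derivative being of class \<open>C\<^sup>k\<close>.\<close>

primrec Ck_on :: "nat \<Rightarrow> ('a::euclidean_space \<Rightarrow> 'b::real_normed_vector) \<Rightarrow> 'a set \<Rightarrow> bool"
  where
    "Ck_on 0 f S \<longleftrightarrow> continuous_on S f"
  | "Ck_on (Suc k) f S \<longleftrightarrow>
       f differentiable_on S \<and> (\<forall>v. Ck_on k (\<lambda>x. frechet_derivative f (at x) v) S)"

definition Cinf_on :: "('a::euclidean_space \<Rightarrow> 'b::real_normed_vector) \<Rightarrow> 'a set \<Rightarrow> bool"
  where "Cinf_on f S \<longleftrightarrow> (\<forall>k. Ck_on k f S)"

text \<open>The point set of a manifold is a (Hausdorff, second countable) type \<open>'m\<close>; a chart is a pair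
  of a domain and a coordinate map, the values of which outside the domain are irrelevant.
  An atlas need not be maximal: the notions below only depend on the smooth structure that it
  generates. The dimension is that of the model space \<open>'e\<close>.\<close>

type_synonym ('m, 'e) chart = "'m set \<times> ('m \<Rightarrow> 'e)"

definition is_chart :: "('m::topological_space, 'e::euclidean_space) chart \<Rightarrow> bool"
  where "is_chart = (\<lambda>(U, c). open U \<and> open (c ` U) \<and> homeomorphism U (c ` U) c (inv_into U c))"

definition smooth_compatible ::
    "('m::topological_space, 'e::euclidean_space) chart \<Rightarrow> ('m, 'e) chart \<Rightarrow> bool"
  where "smooth_compatible = (\<lambda>(U, c) (V, d). Cinf_on (d \<circ> inv_into U c) (c ` (U \<inter> V)))"

locale smooth_manifold =
  fixes A :: "('m::{t2_space, second_countable_topology}, 'e::euclidean_space) chart set"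
  assumes charts: "a \<in> A \<Longrightarrow> is_chart a"
    and compatible: "a \<in> A \<Longrightarrow> b \<in> A \<Longrightarrow> smooth_compatible a b"
    and covering: "\<Union> (fst ` A) = UNIV"

definition smooth_functions :: "('m, 'e::euclidean_space) chart set \<Rightarrow> ('m \<Rightarrow> real) set"
  where "smooth_functions A = {f. \<forall>(U, c) \<in> A. Cinf_on (f \<circ> inv_into U c) (c ` U)}"


section \<open>Tangent vectors and vector fields\<close>

text \<open>Tangent vectors at \<open>p\<close> are the derivations at \<open>p\<close> of the algebra of smooth functions. Since
  HOL functions are total, they are made to vanish on functions that are not smooth, so that
  equality of tangent vectors is equality in HOL.\<close>

type_synonym 'm tvec = "('m \<Rightarrow> real) \<Rightarrow> real"
type_synonym 'm vfield = "'m \<Rightarrow> 'm tvec"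

definition tangent_space :: "('m, 'e::euclidean_space) chart set \<Rightarrow> 'm \<Rightarrow> 'm tvec set"
  where "tangent_space A p = {v.
    (\<forall>f\<in>smooth_functions A. \<forall>h\<in>smooth_functions A. \<forall>a b.
        v (\<lambda>x. a * f x + b * h x) = a * v f + b * v h) \<and>
    (\<forall>f\<in>smooth_functions A. \<forall>h\<in>smooth_functions A.
        v (\<lambda>x. f x * h x) = v f * h p + f p * v h) \<and>
    (\<forall>f. f \<notin> smooth_functions A \<longrightarrow> v f = 0)}"

definition vector_fields :: "('m, 'e::euclidean_space) chart set \<Rightarrow> 'm vfield set"
  where "vector_fields A = {X. (\<forall>p. X p \<in> tangent_space A p) \<and>
    (\<forall>f\<in>smooth_functions A. (\<lambda>p. X p f) \<in> smooth_functions A)}"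

definition scale_field :: "('m \<Rightarrow> real) \<Rightarrow> 'm vfield \<Rightarrow> 'm vfield"
  where "scale_field f X = (\<lambda>p. f p *\<^sub>R X p)"

text \<open>\<open>[X,Y] f = X (Y f) - Y (X f)\<close>; this is again zero on functions that are not smooth.\<close>

definition lie_bracket :: "'m vfield \<Rightarrow> 'm vfield \<Rightarrow> 'm vfield"
  where "lie_bracket X Y = (\<lambda>p f. X p (\<lambda>q. Y q f) - Y p (\<lambda>q. X q f))"


section \<open>Tensor fields\<close>

definition linear_map_on :: "'v::real_vector set \<Rightarrow> ('v \<Rightarrow> 'w::real_vector) \<Rightarrow> bool"
  where "linear_map_on V T \<longleftrightarrow>
    (\<forall>x\<in>V. \<forall>y\<in>V. \<forall>a b. T (a *\<^sub>R x + b *\<^sub>R y) = a *\<^sub>R T x + b *\<^sub>R T y)"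

text \<open>Tensor fields are given by their values on tangent spaces; they are smooth if they map
  smooth vector fields to smooth objects. Their values on functionals that are not tangent
  vectors are irrelevant.\<close>

definition one_form :: "('m, 'e::euclidean_space) chart set \<Rightarrow> ('m \<Rightarrow> 'm tvec \<Rightarrow> real) \<Rightarrow> bool"
  where "one_form A \<eta> \<longleftrightarrow>
    (\<forall>p. linear_map_on (tangent_space A p) (\<eta> p)) \<and>
    (\<forall>X\<in>vector_fields A. (\<lambda>p. \<eta> p (X p)) \<in> smooth_functions A)"

definition apply_endo :: "('m \<Rightarrow> 'm tvec \<Rightarrow> 'm tvec) \<Rightarrow> 'm vfield \<Rightarrow> 'm vfield"
  where "apply_endo \<phi> X = (\<lambda>p. \<phi> p (X p))"

definition endo_field ::
    "('m, 'e::euclidean_space) chart set \<Rightarrow> ('m \<Rightarrow> 'm tvec \<Rightarrow> 'm tvec) \<Rightarrow> bool"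
  where "endo_field A \<phi> \<longleftrightarrow>
    (\<forall>p. linear_map_on (tangent_space A p) (\<phi> p) \<and>
         \<phi> p ` tangent_space A p \<subseteq> tangent_space A p) \<and>
    (\<forall>X\<in>vector_fields A. apply_endo \<phi> X \<in> vector_fields A)"

text \<open>The index of a symmetric bilinear form: the largest dimension of a negative definite
  subspace.\<close>

definition form_index :: "'v::real_vector set \<Rightarrow> ('v \<Rightarrow> 'v \<Rightarrow> real) \<Rightarrow> nat"
  where "form_index V b =
    Max {dim W | W. subspace W \<and> W \<subseteq> V \<and> (\<forall>w\<in>W. w \<noteq> 0 \<longrightarrow> b w w < 0)}"

definition semi_riemannian_metric ::
    "('m, 'e::euclidean_space) chart set \<Rightarrow> ('m \<Rightarrow> 'm tvec \<Rightarrow> 'm tvec \<Rightarrow> real) \<Rightarrow> bool"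
  where "semi_riemannian_metric A g \<longleftrightarrow>
    (\<forall>p. \<forall>v\<in>tangent_space A p. linear_map_on (tangent_space A p) (g p v)) \<and>
    (\<forall>p. \<forall>v\<in>tangent_space A p. \<forall>w\<in>tangent_space A p. g p v w = g p w v) \<and>
    (\<forall>p. \<forall>v\<in>tangent_space A p. (\<forall>w\<in>tangent_space A p. g p v w = 0) \<longrightarrow> v = 0) \<and>
    (\<forall>X\<in>vector_fields A. \<forall>Y\<in>vector_fields A. (\<lambda>p. g p (X p) (Y p)) \<in> smooth_functions A) \<and>
    (\<exists>\<nu>. \<forall>p. form_index (tangent_space A p) (g p) = \<nu>)"


section \<open>Connections and curvature\<close>

type_synonym 'm connection = "'m vfield \<Rightarrow> 'm vfield \<Rightarrow> 'm vfield"

text \<open>\<open>D X Y\<close> is the covariant derivative of \<open>Y\<close> along \<open>X\<close>.\<close>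

definition affine_connection :: "('m, 'e::euclidean_space) chart set \<Rightarrow> 'm connection \<Rightarrow> bool"
  where "affine_connection A D \<longleftrightarrow>
    (\<forall>X\<in>vector_fields A. \<forall>Y\<in>vector_fields A. D X Y \<in> vector_fields A) \<and>
    (\<forall>X\<in>vector_fields A. \<forall>Y\<in>vector_fields A. \<forall>Z\<in>vector_fields A.
      \<forall>f\<in>smooth_functions A. \<forall>h\<in>smooth_functions A.
        D (scale_field f X + scale_field h Y) Z = scale_field f (D X Z) + scale_field h (D Y Z)) \<and>
    (\<forall>X\<in>vector_fields A. \<forall>Y\<in>vector_fields A. \<forall>Z\<in>vector_fields A.
        D X (Y + Z) = D X Y + D X Z) \<and>
    (\<forall>X\<in>vector_fields A. \<forall>Y\<in>vector_fields A. \<forall>f\<in>smooth_functions A.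
        D X (scale_field f Y) = scale_field (\<lambda>p. X p f) Y + scale_field f (D X Y))"

definition levi_civita_connection ::
    "('m, 'e::euclidean_space) chart set \<Rightarrow> ('m \<Rightarrow> 'm tvec \<Rightarrow> 'm tvec \<Rightarrow> real) \<Rightarrow> 'm connection \<Rightarrow> bool"
  where "levi_civita_connection A g D \<longleftrightarrow> affine_connection A D \<and>
    (\<forall>X\<in>vector_fields A. \<forall>Y\<in>vector_fields A. D X Y - D Y X = lie_bracket X Y) \<and>
    (\<forall>X\<in>vector_fields A. \<forall>Y\<in>vector_fields A. \<forall>Z\<in>vector_fields A. \<forall>p.
        X p (\<lambda>q. g q (Y q) (Z q)) = g p (D X Y p) (Z p) + g p (Y p) (D X Z p))"

definition cov_deriv_endo ::
    "'m connection \<Rightarrow> ('m \<Rightarrow> 'm tvec \<Rightarrow> 'm tvec) \<Rightarrow> 'm vfield \<Rightarrow> 'm vfield \<Rightarrow> 'm vfield"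
  where "cov_deriv_endo D \<phi> X Y = D X (apply_endo \<phi> Y) - apply_endo \<phi> (D X Y)"

definition curvature :: "'m connection \<Rightarrow> 'm vfield \<Rightarrow> 'm vfield \<Rightarrow> 'm vfield \<Rightarrow> 'm vfield"
  where "curvature D X Y Z = D X (D Y Z) - D Y (D X Z) - D (lie_bracket X Y) Z"

text \<open>\<open>curvature\<close> is \<open>C\<^sup>\<infinity>\<close>-trilinear, so its value at \<open>p\<close> depends only on the values of the fields
  at \<open>p\<close>. The induced trilinear map on the tangent space at \<open>p\<close> is evaluated by extending the
  tangent vectors to vector fields; the choice of the extensions does not matter.\<close>

definition extend_vec :: "('m, 'e::euclidean_space) chart set \<Rightarrow> 'm \<Rightarrow> 'm tvec \<Rightarrow> 'm vfield"
  where "extend_vec A p v = (SOME X. X \<in> vector_fields A \<and> X p = v)"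

definition curvature_at :: "('m, 'e::euclidean_space) chart set \<Rightarrow> 'm connection \<Rightarrow> 'm \<Rightarrow>
    'm tvec \<Rightarrow> 'm tvec \<Rightarrow> 'm tvec \<Rightarrow> 'm tvec"
  where "curvature_at A D p x y z =
    curvature D (extend_vec A p x) (extend_vec A p y) (extend_vec A p z) p"

text \<open>Trace of an endomorphism of a finite-dimensional subspace \<open>V\<close>: the sum of the diagonal
  entries of its matrix with respect to any basis of \<open>V\<close>.\<close>

definition trace_on :: "'v::real_vector set \<Rightarrow> ('v \<Rightarrow> 'v) \<Rightarrow> real"
  where "trace_on V T =
    (let B = (SOME B. independent B \<and> span B = V) in \<Sum>b\<in>B. representation B (T b) b)"

definition ricci_tensor :: "('m, 'e::euclidean_space) chart set \<Rightarrow> 'm connection \<Rightarrow> 'm \<Rightarrow>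
    'm tvec \<Rightarrow> 'm tvec \<Rightarrow> real"
  where "ricci_tensor A D p y z = trace_on (tangent_space A p) (\<lambda>x. curvature_at A D p x y z)"

definition ricci_operator :: "('m, 'e::euclidean_space) chart set \<Rightarrow>
    ('m \<Rightarrow> 'm tvec \<Rightarrow> 'm tvec \<Rightarrow> real) \<Rightarrow> 'm connection \<Rightarrow> 'm \<Rightarrow> 'm tvec \<Rightarrow> 'm tvec"
  where "ricci_operator A g D p x =
    (THE w. w \<in> tangent_space A p \<and> (\<forall>y\<in>tangent_space A p. g p w y = ricci_tensor A D p x y))"

definition scalar_curvature :: "('m, 'e::euclidean_space) chart set \<Rightarrow>
    ('m \<Rightarrow> 'm tvec \<Rightarrow> 'm tvec \<Rightarrow> real) \<Rightarrow> 'm connection \<Rightarrow> 'm \<Rightarrow> real"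
  where "scalar_curvature A g D p = trace_on (tangent_space A p) (ricci_operator A g D p)"

definition indefinite_space_form :: "('m, 'e::euclidean_space) chart set \<Rightarrow>
    ('m \<Rightarrow> 'm tvec \<Rightarrow> 'm tvec \<Rightarrow> real) \<Rightarrow> 'm connection \<Rightarrow> bool"
  where "indefinite_space_form A g D \<longleftrightarrow>
    (\<exists>c::real. \<forall>X\<in>vector_fields A. \<forall>Y\<in>vector_fields A. \<forall>Z\<in>vector_fields A. \<forall>p.
       curvature D X Y Z p = c *\<^sub>R (g p (Y p) (Z p) *\<^sub>R X p - g p (X p) (Z p) *\<^sub>R Y p))"


section \<open>Almost paracontact structures\<close>

locale almost_paracontact_manifold = smooth_manifold A
  for A :: "('m::{t2_space, second_countable_topology}, 'e::euclidean_space) chart set" +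
  fixes \<phi> :: "'m \<Rightarrow> 'm tvec \<Rightarrow> 'm tvec"
    and \<xi> :: "'m vfield"
    and \<eta> :: "'m \<Rightarrow> 'm tvec \<Rightarrow> real"
  assumes phi_tensor: "endo_field A \<phi>"
    and xi_field: "\<xi> \<in> vector_fields A"
    and eta_form: "one_form A \<eta>"
    and phi_square: "v \<in> tangent_space A p \<Longrightarrow> \<phi> p (\<phi> p v) = v - \<eta> p v *\<^sub>R \<xi> p"
    and eta_xi: "\<eta> p (\<xi> p) = 1"
    and phi_xi: "\<phi> p (\<xi> p) = 0"
    and eta_phi: "v \<in> tangent_space A p \<Longrightarrow> \<eta> p (\<phi> p v) = 0"

locale eps_almost_paracontact_metric_manifold = almost_paracontact_manifold A \<phi> \<xi> \<eta>
  for A :: "('m::{t2_space, second_countable_topology}, 'e::euclidean_space) chart set"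
    and \<phi> \<xi> \<eta> +
  fixes g :: "'m \<Rightarrow> 'm tvec \<Rightarrow> 'm tvec \<Rightarrow> real"
    and \<epsilon> :: real
  assumes metric: "semi_riemannian_metric A g"
    and eps: "\<epsilon> \<in> {1, -1}"
    and metric_phi: "X \<in> vector_fields A \<Longrightarrow> Y \<in> vector_fields A \<Longrightarrow>
      g p (\<phi> p (X p)) (\<phi> p (Y p)) = g p (X p) (Y p) - \<epsilon> * \<eta> p (X p) * \<eta> p (Y p)"

text \<open>The Levi-Civita connection \<open>D\<close> is a parameter of the locale; it is uniquely determined by
  the metric on smooth vector fields.\<close>

locale eps_para_sasakian_manifold = eps_almost_paracontact_metric_manifold A \<phi> \<xi> \<eta> g \<epsilon>
  for A :: "('m::{t2_space, second_countable_topology}, 'e::euclidean_space) chart set"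
    and \<phi> \<xi> \<eta> g \<epsilon> +
  fixes D :: "'m connection"
  assumes levi_civita: "levi_civita_connection A g D"
    and para_sasakian: "X \<in> vector_fields A \<Longrightarrow> Y \<in> vector_fields A \<Longrightarrow>
      cov_deriv_endo D \<phi> X Y p =
        - (g p (\<phi> p (X p)) (\<phi> p (Y p)) *\<^sub>R \<xi> p) - (\<epsilon> * \<eta> p (Y p)) *\<^sub>R \<phi> p (\<phi> p (X p))"

end

theory Submission
  imports Defs
begin

text \<open>
  The defining identity for \<open>\<nabla>\<phi>\<close> forces \<open>\<nabla>\<^sub>X \<xi> = \<epsilon> \<phi> X\<close> (\<open>D_xi\<close>), hence
  \<open>R(X,Y)\<xi> = \<eta>(X)Y - \<eta>(Y)X\<close> (\<open>curvature_xi\<close>). As \<open>g(X,\<xi>) = \<epsilon> \<eta>(X)\<close>, this is exactly what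
  constant curvature \<open>-\<epsilon>\<close> would give for \<open>R(X,Y)\<xi>\<close>; in particular \<open>-\<epsilon>\<close> is the only possible
  constant. So the difference \<open>T\<close> of \<open>R\<close> and the model tensor of curvature \<open>-\<epsilon>\<close> has all the
  symmetries of a curvature tensor and satisfies \<open>T(X,Y)\<xi> = 0\<close>. In dimension three \<open>\<xi>\<close> can be
  completed to an orthogonal basis \<open>\<xi>, a, b\<close> without null vectors, and these symmetries leave a single
  component of \<open>T\<close> free, namely \<open>g(T(a,b)b,a)\<close>
  (\<open>curvature_zero_if_nullity_and_sectional_zero\<close>). Taking traces in that basis,
  \<open>r = 2 K - 4 \<epsilon>\<close> where \<open>K = g(R(a,b)b,a) / (g(a,a) g(b,b))\<close>
  (\<open>scalar_curvature_sectional\<close>). Thus \<open>r = -6 \<epsilon>\<close> says \<open>K = -\<epsilon>\<close>, which says that the free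
  component of \<open>T\<close> vanishes, which says \<open>T = 0\<close>.

  This pointwise argument needs three facts about tangent vectors understood as derivations of the
  algebra of global smooth functions. Every derivation at a point is a directional derivative in a
  chart (\<open>centred_chart.tangent_at_centre\<close>, from Hadamard's lemma), so that tangent spaces have the
  dimension of the model space. Every tangent vector extends to a vector field (\<open>extend_vec\<close>). And a
  map of vector fields that is linear over the smooth functions acts pointwise (\<open>tensorial_pointwise\<close>),
  so that the curvature is a tensor on each tangent space. All three rest on a smooth bump function
  in a chart, normalized to have value one at its centre: multiplying an identity by powers of such a
  function makes all its terms global and does not change it at the centre.
\<close>


section \<open>Functions of class C^k\<close>

lemma frechet_derivative_cong_open:
  assumes "open S" "x \<in> S" "\<And>y. y \<in> S \<Longrightarrow> f y = g y"
  shows "frechet_derivative f (at x) = frechet_derivative g (at x)"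
proof -
  have "(f has_derivative D) (at x) \<longleftrightarrow> (g has_derivative D) (at x)" for D
    using has_derivative_transform_within_open[of f D x UNIV S g]
      has_derivative_transform_within_open[of g D x UNIV S f] assms by (metis (full_types))
  then show ?thesis by (simp add: frechet_derivative_def)
qed

lemma Ck_on_has_derivative:
  assumes "open S" "Ck_on (Suc k) f S" "x \<in> S"
  shows "(f has_derivative frechet_derivative f (at x)) (at x)"
  using assms by (metis Ck_on.simps(2) at_within_open differentiable_on_def frechet_derivative_works)

lemma Ck_on_cong:
  assumes "open S"
  shows "(\<And>x. x \<in> S \<Longrightarrow> f x = g x) \<Longrightarrow> Ck_on k f S \<Longrightarrow> Ck_on k g S"
proof (induction k arbitrary: f g)
  case 0
  then show ?case by (simp cong: continuous_on_cong)
next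
  case (Suc k)
  have eq: "frechet_derivative f (at x) = frechet_derivative g (at x)" if "x \<in> S" for x
    using assms that Suc.prems(1) by (rule frechet_derivative_cong_open)
  have "g differentiable_on S"
    using Suc.prems differentiable_transform_within[of f _ S 1 g] by (simp add: differentiable_on_def)
  moreover have "Ck_on k (\<lambda>x. frechet_derivative g (at x) v) S" for v
    by (rule Suc.IH[of "\<lambda>x. frechet_derivative f (at x) v"]) (use eq Suc.prems(2) in auto)
  ultimately show ?case by simp
qed

lemma Ck_on_SucI:
  assumes "open S" and der: "\<And>x. x \<in> S \<Longrightarrow> (f has_derivative f' x) (at x)"
    and Ck: "\<And>v. Ck_on k (\<lambda>x. f' x v) S"
  shows "Ck_on (Suc k) f S"
proof -
  have "f differentiable_on S"
    using der by (meson differentiable_at_withinI differentiable_def differentiable_on_def)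
  moreover have "Ck_on k (\<lambda>x. frechet_derivative f (at x) v) S" for v
    by (rule Ck_on_cong[OF assms(1) _ Ck[of v]]) (use frechet_derivative_at[OF der] in simp)
  ultimately show ?thesis by simp
qed

lemma Ck_on_SucD: "Ck_on (Suc k) f S \<Longrightarrow> Ck_on k f S"
proof (induction k arbitrary: f)
  case 0
  then show ?case by (simp add: differentiable_imp_continuous_on)
next
  case (Suc k)
  have "Ck_on k (\<lambda>x. frechet_derivative f (at x) v) S" for v
    using Suc.IH Suc.prems by auto
  with Suc.prems show ?case by auto
qed

lemma Ck_on_subset: "Ck_on k f S \<Longrightarrow> T \<subseteq> S \<Longrightarrow> Ck_on k f T"
proof (induction k arbitrary: f)
  case 0
  then show ?case by (auto intro: continuous_on_subset)
next
  case (Suc k)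
  then show ?case by (auto intro: differentiable_on_subset)
qed

lemma Ck_on_local:
  assumes "\<And>x. x \<in> S \<Longrightarrow> \<exists>T. open T \<and> x \<in> T \<and> T \<subseteq> S \<and> Ck_on k f T"
  shows "Ck_on k f S"
  using assms
proof (induction k arbitrary: f)
  case 0
  have "isCont f x" if "x \<in> S" for x
    using 0[OF that] by (auto simp: continuous_on_eq_continuous_at)
  then show ?case by (auto intro: continuous_at_imp_continuous_on)
next
  case (Suc k)
  have "f differentiable (at x)" if "x \<in> S" for x
    using Suc.prems[OF that] by (metis Ck_on.simps(2) at_within_open differentiable_on_def)
  then have "f differentiable_on S"
    by (simp add: differentiable_at_imp_differentiable_on)
  moreover have "Ck_on k (\<lambda>x. frechet_derivative f (at x) v) S" for v
    using Suc.prems by (intro Suc.IH) force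
  ultimately show ?case by simp
qed

lemma Ck_on_const: "open S \<Longrightarrow> Ck_on k (\<lambda>x. c) S"
proof (induction k arbitrary: c)
  case (Suc k)
  show ?case
    by (rule Ck_on_SucI[where f' = "\<lambda>x v. 0"]) (use Suc in auto)
qed simp

lemma Ck_on_bounded_linear:
  assumes L: "bounded_linear L" and "open S"
  shows "Ck_on k f S \<Longrightarrow> Ck_on k (\<lambda>x. L (f x)) S"
proof (induction k arbitrary: f)
  case 0
  then show ?case by (simp add: bounded_linear.continuous_on[OF L])
next
  case (Suc k)
  show ?case
    by (rule Ck_on_SucI[where f' = "\<lambda>x v. L (frechet_derivative f (at x) v)"])
      (use Suc assms(2) bounded_linear.has_derivative[OF L Ck_on_has_derivative[OF assms(2) Suc.prems]] in auto)
qed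

lemma Ck_on_ident: "open S \<Longrightarrow> Ck_on k (\<lambda>x. x) S"
proof (cases k)
  case (Suc n)
  assume "open S"
  then show ?thesis unfolding Suc
    by (intro Ck_on_SucI[where f' = "\<lambda>x v. v"]) (auto intro: Ck_on_const)
qed simp

lemma Ck_on_add:
  assumes "open S"
  shows "Ck_on k f S \<Longrightarrow> Ck_on k g S \<Longrightarrow> Ck_on k (\<lambda>x. f x + g x) S"
proof (induction k arbitrary: f g)
  case 0
  then show ?case by (simp add: continuous_on_add)
next
  case (Suc k)
  show ?case
    by (rule Ck_on_SucI[where f' = "\<lambda>x v. frechet_derivative f (at x) v + frechet_derivative g (at x) v"])
      (use Suc assms in \<open>auto intro!: has_derivative_add Ck_on_has_derivative simp del: Ck_on.simps(2)\<close>,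
       use Suc in auto)
qed

lemma Ck_on_sum:
  assumes "open S" "\<And>i. i \<in> I \<Longrightarrow> Ck_on k (f i) S"
  shows "Ck_on k (\<lambda>x. \<Sum>i\<in>I. f i x) S"
  using assms(2)
proof (induction I rule: infinite_finite_induct)
  case (insert i I)
  then show ?case by (simp add: Ck_on_add[OF assms(1)])
qed (simp_all add: Ck_on_const[OF assms(1)])

lemma (in bounded_bilinear) Ck_on_prod:
  assumes "open S"
  shows "Ck_on k f S \<Longrightarrow> Ck_on k g S \<Longrightarrow> Ck_on k (\<lambda>x. prod (f x) (g x)) S"
proof (induction k arbitrary: f g)
  case 0
  then show ?case by (simp add: continuous_on)
next
  case (Suc k)
  show ?case
  proof (rule Ck_on_SucI[OF assms])
    fix x assume "x \<in> S"
    then show "((\<lambda>x. prod (f x) (g x)) has_derivative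
       (\<lambda>v. prod (f x) (frechet_derivative g (at x) v) + prod (frechet_derivative f (at x) v) (g x))) (at x)"
      using FDERIV[OF Ck_on_has_derivative[OF assms Suc.prems(1)] Ck_on_has_derivative[OF assms Suc.prems(2)]] by blast
  next
    fix v
    show "Ck_on k (\<lambda>x. prod (f x) (frechet_derivative g (at x) v) + prod (frechet_derivative f (at x) v) (g x)) S"
      using Suc.prems Ck_on_SucD[OF Suc.prems(1)] Ck_on_SucD[OF Suc.prems(2)]
      by (intro Ck_on_add[OF assms] Suc.IH) auto
  qed
qed

text \<open>The induction needs a derivative that is again built from compositions of the same kind. Expanding
  the inner derivative in the standard basis turns the chain rule into a finite sum of products of
  directional derivatives of \<open>f\<close> with directional derivatives of \<open>g\<close> composed with \<open>f\<close>.\<close>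

lemma Ck_on_compose:
  fixes f :: "'a::euclidean_space \<Rightarrow> 'b::euclidean_space"
  assumes "open S" "open T" and fS: "\<And>x. x \<in> S \<Longrightarrow> f x \<in> T"
  shows "Ck_on k f S \<Longrightarrow> Ck_on k g T \<Longrightarrow> Ck_on k (\<lambda>x. g (f x)) S"
proof (induction k arbitrary: g)
  case 0
  have "f ` S \<subseteq> T" using fS by auto
  with 0 show ?case by (auto intro: continuous_on_compose2)
next
  case (Suc k)
  let ?Df = "\<lambda>x. frechet_derivative f (at x)" and ?Dg = "\<lambda>y. frechet_derivative g (at y)"
  show ?case
  proof (rule Ck_on_SucI[OF assms(1)])
    fix x assume x: "x \<in> S"
    have df: "(f has_derivative ?Df x) (at x)"
      by (rule Ck_on_has_derivative[OF assms(1) Suc.prems(1) x])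
    have dg: "(g has_derivative ?Dg (f x)) (at (f x))"
      by (rule Ck_on_has_derivative[OF assms(2) Suc.prems(2) fS[OF x]])
    have "?Dg (f x) w = (\<Sum>b\<in>Basis. (w \<bullet> b) *\<^sub>R ?Dg (f x) b)" for w
    proof -
      have l: "linear (?Dg (f x))" using dg has_derivative_linear by blast
      have "?Dg (f x) w = ?Dg (f x) (\<Sum>b\<in>Basis. (w \<bullet> b) *\<^sub>R b)" by (simp add: euclidean_representation)
      then show ?thesis by (simp add: linear_sum[OF l] linear_scale[OF l])
    qed
    then have eq: "(\<lambda>v. \<Sum>b\<in>Basis. (?Df x v \<bullet> b) *\<^sub>R ?Dg (f x) b) = (\<lambda>v. ?Dg (f x) (?Df x v))"
      by (intro ext) (rule sym)
    show "((\<lambda>x. g (f x)) has_derivative (\<lambda>v. \<Sum>b\<in>Basis. (?Df x v \<bullet> b) *\<^sub>R ?Dg (f x) b)) (at x)"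
      unfolding eq by (rule has_derivative_compose[OF df dg])
  next
    fix v
    have "Ck_on k (\<lambda>x. ?Df x v \<bullet> b) S" for b
      using Suc.prems by (intro Ck_on_bounded_linear[OF bounded_linear_inner_left assms(1)]) simp
    moreover have "Ck_on k (\<lambda>x. ?Dg (f x) b) S" for b
      using Suc.prems Ck_on_SucD[OF Suc.prems(1)] by (intro Suc.IH) auto
    ultimately show "Ck_on k (\<lambda>x. \<Sum>b\<in>Basis. (?Df x v \<bullet> b) *\<^sub>R ?Dg (f x) b) S"
      by (intro Ck_on_sum[OF assms(1)] bounded_bilinear.Ck_on_prod[OF bounded_bilinear_scaleR assms(1)])
  qed
qed

lemma Cinf_on_cong: "open S \<Longrightarrow> (\<And>x. x \<in> S \<Longrightarrow> f x = g x) \<Longrightarrow> Cinf_on f S \<Longrightarrow> Cinf_on g S"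
  unfolding Cinf_on_def using Ck_on_cong by blast

lemma Cinf_on_subset: "Cinf_on f S \<Longrightarrow> T \<subseteq> S \<Longrightarrow> Cinf_on f T"
  unfolding Cinf_on_def using Ck_on_subset by blast

lemma Cinf_on_local:
  assumes "\<And>x. x \<in> S \<Longrightarrow> \<exists>T. open T \<and> x \<in> T \<and> T \<subseteq> S \<and> Cinf_on f T"
  shows "Cinf_on f S"
  unfolding Cinf_on_def
proof (intro allI Ck_on_local)
  fix k x assume "x \<in> S"
  then obtain T where "open T" "x \<in> T" "T \<subseteq> S" "Cinf_on f T" using assms by blast
  then show "\<exists>T. open T \<and> x \<in> T \<and> T \<subseteq> S \<and> Ck_on k f T" by (auto simp: Cinf_on_def)
qed

lemma Cinf_on_const: "open S \<Longrightarrow> Cinf_on (\<lambda>x. c) S"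
  by (simp add: Cinf_on_def Ck_on_const)

lemma Cinf_on_ident: "open S \<Longrightarrow> Cinf_on (\<lambda>x. x) S"
  by (simp add: Cinf_on_def Ck_on_ident)

lemma Cinf_on_add: "open S \<Longrightarrow> Cinf_on f S \<Longrightarrow> Cinf_on g S \<Longrightarrow> Cinf_on (\<lambda>x. f x + g x) S"
  by (simp add: Cinf_on_def Ck_on_add)

lemma Cinf_on_mult:
  fixes f g :: "_ \<Rightarrow> real"
  shows "open S \<Longrightarrow> Cinf_on f S \<Longrightarrow> Cinf_on g S \<Longrightarrow> Cinf_on (\<lambda>x. f x * g x) S"
  by (simp add: Cinf_on_def bounded_bilinear.Ck_on_prod[OF bounded_bilinear_mult])

lemma Cinf_on_inner:
  "open S \<Longrightarrow> Cinf_on f S \<Longrightarrow> Cinf_on g S \<Longrightarrow> Cinf_on (\<lambda>x. f x \<bullet> g x) S"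
  by (simp add: Cinf_on_def bounded_bilinear.Ck_on_prod[OF bounded_bilinear_inner])

lemma Cinf_on_diff:
  fixes f g :: "_ \<Rightarrow> _::real_normed_vector"
  assumes "open S" "Cinf_on f S" "Cinf_on g S" shows "Cinf_on (\<lambda>x. f x - g x) S"
  using Ck_on_add[OF assms(1), of _ f "\<lambda>x. - g x"] assms
     Ck_on_bounded_linear[OF bounded_linear_minus[OF bounded_linear_ident] assms(1), of _ g]
  by (simp add: Cinf_on_def)

lemma Cinf_on_compose:
  fixes f :: "'a::euclidean_space \<Rightarrow> 'b::euclidean_space"
  assumes "open S" "open T" "\<And>x. x \<in> S \<Longrightarrow> f x \<in> T" "Cinf_on f S" "Cinf_on g T"
  shows "Cinf_on (\<lambda>x. g (f x)) S"
  using assms by (simp add: Cinf_on_def Ck_on_compose)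

lemma Cinf_on_has_derivative:
  assumes "open S" "Cinf_on f S" "x \<in> S"
  shows "(f has_derivative frechet_derivative f (at x)) (at x)"
  using assms Ck_on_has_derivative[of S 0 f x] by (auto simp: Cinf_on_def simp del: Ck_on.simps)

lemma Cinf_on_directional_derivative:
  "Cinf_on f S \<Longrightarrow> Cinf_on (\<lambda>x. frechet_derivative f (at x) v) S"
  by (metis Ck_on.simps(2) Cinf_on_def)

section \<open>Bump functions\<close>

lemma Ck_on_imp_continuous_on: "Ck_on k f S \<Longrightarrow> continuous_on S f"
  by (cases k) (auto simp: differentiable_imp_continuous_on)

text \<open>The classical flat function is the case \<open>n = 0\<close>. The powers of \<open>t\<close> in the denominator make the
  family closed under differentiation, which gives smoothness by induction.\<close>

definition flat :: "nat \<Rightarrow> real \<Rightarrow> real"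
  where "flat n t = (if t > 0 then exp (- 1 / t) / t ^ n else 0)"

lemma flat_tendsto_0: "(flat n \<longlongrightarrow> 0) (at 0)"
proof -
  have "((\<lambda>u::real. u ^ n / exp u) \<longlongrightarrow> 0) at_top"
    by (rule tendsto_power_div_exp_0)
  moreover have "eventually (\<lambda>u. u ^ n / exp u = flat n (inverse u)) at_top"
    using eventually_gt_at_top[of 0]
    by eventually_elim (simp add: flat_def exp_minus field_simps)
  ultimately have "((\<lambda>u. flat n (inverse u)) \<longlongrightarrow> 0) at_top"
    using tendsto_cong by force
  then have "(flat n \<longlongrightarrow> 0) (at_right 0)"
    by (simp add: filterlim_at_right_to_top)
  moreover have "(flat n \<longlongrightarrow> 0) (at_left 0)"
    by (rule tendsto_eventually)
       (auto simp: eventually_at_filter flat_def intro: always_eventually)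
  ultimately show ?thesis by (simp add: filterlim_split_at)
qed

lemma flat_DERIV:
  "(flat n has_real_derivative (flat (n + 2) t - n * flat (Suc n) t)) (at t)"
proof -
  consider "t > 0" | "t < 0" | "t = 0" by linarith
  then show ?thesis
  proof cases
    case 1
    have "((\<lambda>t. exp (- 1 / t) / t ^ n) has_real_derivative (flat (n + 2) t - n * flat (Suc n) t)) (at t)"
      using 1 by (auto intro!: derivative_eq_intros simp: flat_def field_simps power2_eq_square)
         (cases n; simp add: field_simps)
    then show ?thesis
      by (rule has_field_derivative_transform_within_open[where S = "{0<..}"]) (use 1 in \<open>auto simp: flat_def\<close>)
  next
    case 2
    have "((\<lambda>t. 0) has_real_derivative (flat (n + 2) t - n * flat (Suc n) t)) (at t)"
      using 2 by (auto simp: flat_def)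
    then show ?thesis
      by (rule has_field_derivative_transform_within_open[where S = "{..<0}"]) (use 2 in \<open>auto simp: flat_def\<close>)
  next
    case 3
    have "(flat n h - flat n 0) / (h - 0) = flat (Suc n) h" if "h \<noteq> 0" for h
      using that by (simp add: flat_def)
    then have "((\<lambda>h. (flat n h - flat n 0) / (h - 0)) \<longlongrightarrow> 0) (at 0)"
      using flat_tendsto_0[of "Suc n"] by (subst tendsto_cong[of _ "flat (Suc n)"]) (auto simp: eventually_at_filter)
    then show ?thesis
      using 3 by (simp add: has_field_derivative_iff flat_def)
  qed
qed

lemma Cinf_on_flat: "Cinf_on (flat n) UNIV"
proof -
  have "Ck_on k (flat n) UNIV" for k
  proof (induction k arbitrary: n)
    case 0
    have "isCont (flat n) t" for t
      using flat_DERIV DERIV_isCont by blast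
    then show ?case by (simp add: continuous_at_imp_continuous_on)
  next
    case (Suc k)
    show ?case
    proof (rule Ck_on_SucI)
      fix t show "(flat n has_derivative (\<lambda>v. (flat (n + 2) t + (- n) * flat (Suc n) t) * v)) (at t)"
        using has_field_derivative_imp_has_derivative[OF flat_DERIV[of n t]] by simp
    next
      fix v :: real
      show "Ck_on k (\<lambda>t. (flat (n + 2) t + (- n) * flat (Suc n) t) * v) UNIV"
        by (rule Ck_on_bounded_linear[OF bounded_linear_mult_left open_UNIV
              Ck_on_add[OF open_UNIV Suc.IH Ck_on_bounded_linear[OF bounded_linear_mult_right open_UNIV Suc.IH]]])
    qed simp
  qed
  then show ?thesis by (simp add: Cinf_on_def)
qed

text \<open>The normalisation makes the value at the centre one, for \<open>r > 0\<close>. The support is the closed ball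
  of radius \<open>r\<close>.\<close>

definition bump :: "'a::euclidean_space \<Rightarrow> real \<Rightarrow> 'a \<Rightarrow> real"
  where "bump a r x = flat 0 (r\<^sup>2 - (x - a) \<bullet> (x - a)) / flat 0 (r\<^sup>2)"

lemma bump_centre: "r > 0 \<Longrightarrow> bump a r a = 1"
  by (simp add: bump_def flat_def)

lemma bump_outside: "x \<notin> cball a r \<Longrightarrow> r > 0 \<Longrightarrow> bump a r x = 0"
proof -
  assume "x \<notin> cball a r" "r > 0"
  then have "r\<^sup>2 < (norm (x - a))\<^sup>2"
    by (intro power_strict_mono) (auto simp: dist_norm norm_minus_commute)
  then show ?thesis by (simp add: bump_def flat_def power2_norm_eq_inner)
qed

lemma Cinf_on_bump: "Cinf_on (bump a r) UNIV"
proof -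
  have 1: "Cinf_on (\<lambda>x. r\<^sup>2 - (x - a) \<bullet> (x - a)) UNIV"
    by (intro Cinf_on_diff Cinf_on_inner Cinf_on_const Cinf_on_ident open_UNIV)
  have "Cinf_on (\<lambda>x. flat 0 (r\<^sup>2 - (x - a) \<bullet> (x - a))) UNIV"
    using Cinf_on_compose[OF open_UNIV open_UNIV UNIV_I 1 Cinf_on_flat] .
  then have "Cinf_on (\<lambda>x. flat 0 (r\<^sup>2 - (x - a) \<bullet> (x - a)) * (1 / flat 0 (r\<^sup>2))) UNIV"
    by (rule Cinf_on_mult[OF open_UNIV _ Cinf_on_const[OF open_UNIV]])
  then show ?thesis by (simp add: bump_def[abs_def])
qed

lemma Cinf_on_coordinate: "Cinf_on (\<lambda>x. (x - a) \<bullet> b) (S :: 'a::euclidean_space set)"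
proof (rule Cinf_on_subset)
  show "Cinf_on (\<lambda>x. (x - a) \<bullet> b) (UNIV :: 'a set)"
    by (intro Cinf_on_inner Cinf_on_diff Cinf_on_const Cinf_on_ident open_UNIV)
qed simp

lemma frechet_derivative_coordinate: "frechet_derivative (\<lambda>x. (x - a) \<bullet> b) (at x) w = w \<bullet> (b :: 'a::euclidean_space)"
proof -
  have "((\<lambda>x. (x - a) \<bullet> b) has_derivative (\<lambda>w. w \<bullet> b)) (at x)"
    by (auto intro!: derivative_eq_intros)
  from frechet_derivative_at[OF this] show ?thesis by (metis)
qed

section \<open>Hadamard's lemma\<close>

lemma ray_in_ball:
  fixes a x :: "'a::real_normed_vector"
  assumes "x \<in> ball a r" "t \<in> {0..1}"
  shows "a + t *\<^sub>R (x - a) \<in> ball a r"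
proof -
  have "norm (t *\<^sub>R (x - a)) \<le> norm (x - a)"
    using assms(2) by (auto intro: mult_left_le_one_le)
  then show ?thesis using assms(1) by (simp add: dist_norm norm_minus_commute)
qed

lemma continuous_on_ray:
  fixes w :: "'a::real_normed_vector \<Rightarrow> 'b::real_normed_vector"
  assumes "continuous_on (ball a r) w"
  shows "continuous_on (ball a r \<times> {0..1}) (\<lambda>(x, t). t ^ n *\<^sub>R w (a + t *\<^sub>R (x - a)))"
proof -
  have "continuous_on (ball a r \<times> {0..1}) (\<lambda>p. w (a + snd p *\<^sub>R (fst p - a)))"
  proof (rule continuous_on_compose2[OF assms])
    show "(\<lambda>p. a + snd p *\<^sub>R (fst p - a)) ` (ball a r \<times> {0..1}) \<subseteq> ball a r"
      using ray_in_ball[of _ a r] by (auto simp del: mem_ball)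
  qed (intro continuous_intros)
  then show ?thesis by (auto simp: case_prod_beta intro!: continuous_intros)
qed

lemma continuous_on_single_ray:
  fixes w :: "'a::real_normed_vector \<Rightarrow> 'b::real_normed_vector"
  assumes "continuous_on (ball a r) w" "x \<in> ball a r"
  shows "continuous_on {0..1} (\<lambda>t. t ^ n *\<^sub>R w (a + t *\<^sub>R (x - a)))"
proof -
  have "continuous_on {0..1} (\<lambda>t. w (a + t *\<^sub>R (x - a)))"
    by (rule continuous_on_compose2[OF assms(1)])
       (intro continuous_intros, use ray_in_ball[OF assms(2)] in \<open>auto simp del: mem_ball\<close>)
  then show ?thesis by (intro continuous_intros)
qed

text \<open>Differentiating under the integral sign produces a factor \<open>t\<close>, so the statement carries an
  arbitrary power of \<open>t\<close> to be inductive.\<close>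

lemma Ck_on_ray_integral:
  fixes u :: "'a::euclidean_space \<Rightarrow> real"
  shows "Ck_on k u (ball a r) \<Longrightarrow>
    Ck_on k (\<lambda>x. integral {0..1} (\<lambda>t. t ^ n *\<^sub>R u (a + t *\<^sub>R (x - a)))) (ball a r)"
proof (induction k arbitrary: n u)
  case 0
  then show ?case
    using integral_continuous_on_param[of "ball a r" 0 "1::real" "\<lambda>x t. t ^ n *\<^sub>R u (a + t *\<^sub>R (x - a))"]
      continuous_on_ray[of a r u n] by (simp add: case_prod_beta)
next
  case (Suc k)
  let ?D = "\<lambda>y. frechet_derivative u (at y)"
  let ?f = "\<lambda>x t. t ^ n *\<^sub>R u (a + t *\<^sub>R (x - a))"
  let ?fx = "\<lambda>x t. t ^ Suc n *\<^sub>R Blinfun (?D (a + t *\<^sub>R (x - a)))"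
  have D: "(u has_derivative ?D y) (at y)" if "y \<in> ball a r" for y
    by (rule Ck_on_has_derivative[OF _ Suc.prems that]) simp
  have app: "blinfun_apply (Blinfun (?D y)) = ?D y" if "y \<in> ball a r" for y
    using D[OF that] by (simp add: has_derivative_bounded_linear bounded_linear_Blinfun_apply)
  have contD: "continuous_on (ball a r) (\<lambda>y. Blinfun (?D y))"
  proof (rule continuous_on_blinfun_componentwise)
    fix i :: 'a
    have "continuous_on (ball a r) (\<lambda>y. ?D y i)"
      using Suc.prems Ck_on_imp_continuous_on by auto
    then show "continuous_on (ball a r) (\<lambda>y. blinfun_apply (Blinfun (?D y)) i)"
      by (rule continuous_on_eq) (simp add: app)
  qed
  from contD have cont: "continuous_on (ball a r \<times> cbox 0 1) (\<lambda>(x, t). ?fx x t)"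
    unfolding cbox_interval by (rule continuous_on_ray)
  have contu: "continuous_on (ball a r \<times> {0..1}) (\<lambda>(x, t). ?f x t)"
    using Suc.prems Ck_on_imp_continuous_on by (intro continuous_on_ray) blast
  have der: "((\<lambda>x. integral (cbox 0 1) (?f x)) has_derivative integral (cbox 0 1) (?fx x)) (at x)"
    if x: "x \<in> ball a r" for x
  proof -
    have "((\<lambda>x. integral (cbox 0 1) (?f x)) has_derivative integral (cbox 0 1) (?fx x)) (at x within ball a r)"
    proof (rule leibniz_rule)
      fix y and t :: real assume y: "y \<in> ball a r" and t: "t \<in> cbox 0 1"
      have in_ball: "a + t *\<^sub>R (y - a) \<in> ball a r" using ray_in_ball y t by auto
      have "((\<lambda>y. a + t *\<^sub>R (y - a)) has_derivative (\<lambda>v. t *\<^sub>R v)) (at y)"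
        by (auto intro!: derivative_eq_intros)
      from has_derivative_compose[OF this D[OF in_ball]]
      have "((\<lambda>y. u (a + t *\<^sub>R (y - a))) has_derivative (\<lambda>v. ?D (a + t *\<^sub>R (y - a)) (t *\<^sub>R v))) (at y)" .
      moreover have "?D (a + t *\<^sub>R (y - a)) (t *\<^sub>R v) = t *\<^sub>R ?D (a + t *\<^sub>R (y - a)) v" for v
        using D[OF in_ball] has_derivative_linear linear_scale by blast
      ultimately have "((\<lambda>y. u (a + t *\<^sub>R (y - a))) has_derivative (\<lambda>v. t *\<^sub>R ?D (a + t *\<^sub>R (y - a)) v)) (at y)"
        by simp
      from has_derivative_scaleR_right[OF this, of "t ^ n"]
      have "((\<lambda>y. ?f y t) has_derivative blinfun_apply (?fx y t)) (at y)"
        by (simp add: app[OF in_ball] blinfun.scaleR_left[abs_def] mult.assoc mult.left_commute)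
      then show "((\<lambda>y. ?f y t) has_derivative blinfun_apply (?fx y t)) (at y within ball a r)"
        by (rule has_derivative_at_withinI)
    next
      fix y assume y: "y \<in> ball a r"
      have "continuous_on {0..1} (?f y)"
        using Suc.prems Ck_on_imp_continuous_on y by (intro continuous_on_single_ray) blast+
      then show "?f y integrable_on cbox 0 1"
        using integrable_continuous_real by auto
    qed (use cont x in auto)
    then show ?thesis by (simp only: at_within_open[OF x open_ball])
  qed
  show ?case
  proof (rule Ck_on_SucI)
    fix x assume x: "x \<in> ball a r"
    have "continuous_on {0..1} (?fx x)"
      by (rule continuous_on_single_ray[OF contD x])
    then have int: "?fx x integrable_on {0..1}"
      by (rule integrable_continuous_real)
    have "blinfun_apply (integral {0..1} (?fx x)) v
        = integral {0..1} (\<lambda>t. t ^ Suc n *\<^sub>R ?D (a + t *\<^sub>R (x - a)) v)" for v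
    proof -
      have "blinfun_apply (integral {0..1} (?fx x)) v = integral {0..1} (\<lambda>t. blinfun_apply (?fx x t) v)"
        by (rule blinfun_apply_integral[OF int])
      also have "\<dots> = integral {0..1} (\<lambda>t. t ^ Suc n *\<^sub>R ?D (a + t *\<^sub>R (x - a)) v)"
        by (intro integral_cong) (use app[OF ray_in_ball[OF x]] in \<open>simp add: blinfun.scaleR_left\<close>)
      finally show ?thesis .
    qed
    then have "blinfun_apply (integral {0..1} (?fx x))
        = (\<lambda>v. integral {0..1} (\<lambda>t. t ^ Suc n *\<^sub>R ?D (a + t *\<^sub>R (x - a)) v))" by blast
    with der[OF x]
    show "((\<lambda>x. integral {0..1} (?f x)) has_derivative
        (\<lambda>v. integral {0..1} (\<lambda>t. t ^ Suc n *\<^sub>R ?D (a + t *\<^sub>R (x - a)) v))) (at x)"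
      by (simp only: cbox_interval)
  next
    fix v show "Ck_on k (\<lambda>x. integral {0..1} (\<lambda>t. t ^ Suc n *\<^sub>R ?D (a + t *\<^sub>R (x - a)) v)) (ball a r)"
      using Suc.prems by (intro Suc.IH) simp
  qed simp
qed

text \<open>The factors are \<open>g b x = \<integral>\<^sub>0\<^sup>1 \<partial>\<^sub>b u(a + t(x - a)) dt\<close>, from the fundamental theorem of calculus along
  the segment from \<open>a\<close> to \<open>x\<close>.\<close>

lemma Hadamard:
  fixes u :: "'a::euclidean_space \<Rightarrow> real"
  assumes "Cinf_on u (ball a r)"
  obtains g where "\<And>b. Cinf_on (g b) (ball a r)"
    and "\<And>b. g b a = frechet_derivative u (at a) b"
    and "\<And>x. x \<in> ball a r \<Longrightarrow> u x = u a + (\<Sum>b\<in>Basis. ((x - a) \<bullet> b) * g b x)"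
proof -
  let ?D = "\<lambda>y. frechet_derivative u (at y)"
  define g where "g b x = integral {0..1} (\<lambda>t. t ^ 0 *\<^sub>R ?D (a + t *\<^sub>R (x - a)) b)" for b x
  show ?thesis
  proof (rule that[of g])
    show "Cinf_on (g b) (ball a r)" for b
      using Ck_on_ray_integral[of _ "\<lambda>x. ?D x b" a r 0] Cinf_on_directional_derivative[OF assms, of b]
      by (simp add: Cinf_on_def g_def[abs_def])
    show "g b a = ?D a b" for b
      by (simp add: g_def)
    fix x assume x: "x \<in> ball a r"
    have D: "(u has_derivative ?D y) (at y)" if "y \<in> ball a r" for y
      by (rule Cinf_on_has_derivative[OF _ assms that]) simp
    have "((\<lambda>t. ?D (a + t *\<^sub>R (x - a)) (x - a)) has_integral (u (a + 1 *\<^sub>R (x - a)) - u (a + 0 *\<^sub>R (x - a)))) {0..1}"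
    proof (rule fundamental_theorem_of_calculus)
      fix t :: real assume t: "t \<in> {0..1}"
      have "((\<lambda>t. a + t *\<^sub>R (x - a)) has_derivative (\<lambda>s. s *\<^sub>R (x - a))) (at t)"
        by (auto intro!: derivative_eq_intros)
      from has_derivative_compose[OF this D[OF ray_in_ball[OF x t]]]
      show "((\<lambda>t. u (a + t *\<^sub>R (x - a))) has_vector_derivative ?D (a + t *\<^sub>R (x - a)) (x - a)) (at t within {0..1})"
        using linear_scale[OF has_derivative_linear[OF D[OF ray_in_ball[OF x t]]]]
        by (auto simp: has_vector_derivative_def intro: has_derivative_at_withinI)
    qed simp
    then have "u x - u a = integral {0..1} (\<lambda>t. ?D (a + t *\<^sub>R (x - a)) (x - a))"
      by (simp add: integral_unique)
    also have "\<dots> = integral {0..1} (\<lambda>t. \<Sum>b\<in>Basis. ((x - a) \<bullet> b) * ?D (a + t *\<^sub>R (x - a)) b)"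
    proof (rule integral_cong)
      fix t :: real assume t: "t \<in> {0..1}"
      let ?L = "?D (a + t *\<^sub>R (x - a))"
      have l: "linear ?L" using D[OF ray_in_ball[OF x t]] has_derivative_linear by blast
      have "?L (x - a) = ?L (\<Sum>b\<in>Basis. ((x - a) \<bullet> b) *\<^sub>R b)" by (simp add: euclidean_representation)
      then show "?L (x - a) = (\<Sum>b\<in>Basis. ((x - a) \<bullet> b) * ?L b)"
        by (simp add: linear_sum[OF l] linear_scale[OF l])
    qed
    also have "\<dots> = (\<Sum>b\<in>Basis. integral {0..1} (\<lambda>t. ((x - a) \<bullet> b) * ?D (a + t *\<^sub>R (x - a)) b))"
    proof (rule integral_sum)
      fix b :: 'a
      have "continuous_on (ball a r) (\<lambda>y. ?D y b)"
        using Cinf_on_directional_derivative[OF assms, of b] Ck_on_imp_continuous_on unfolding Cinf_on_def by blast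
      from continuous_on_single_ray[OF this x, of 0]
      have "continuous_on {0..1} (\<lambda>t. ?D (a + t *\<^sub>R (x - a)) b)" by simp
      then show "(\<lambda>t. ((x - a) \<bullet> b) * ?D (a + t *\<^sub>R (x - a)) b) integrable_on {0..1}"
        by (intro integrable_continuous_real continuous_intros)
    qed simp
    also have "\<dots> = (\<Sum>b\<in>Basis. ((x - a) \<bullet> b) * g b x)"
      by (simp add: g_def)
    finally show "u x = u a + (\<Sum>b\<in>Basis. ((x - a) \<bullet> b) * g b x)" by simp
  qed
qed

section \<open>Smooth functions and derivations\<close>

context smooth_manifold
begin

lemma chart_facts:
  assumes "(U, c) \<in> A"
  shows open_chart_domain: "open U"
    and open_chart_image: "open (c ` U)"
    and chart_inverse: "q \<in> U \<Longrightarrow> inv_into U c (c q) = q"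
    and continuous_on_chart_inverse: "continuous_on (c ` U) (inv_into U c)"
    and open_chart_image_of_open: "open V \<Longrightarrow> open (c ` (U \<inter> V))"
proof -
  have "is_chart (U, c)" using charts assms by blast
  then have hom: "homeomorphism U (c ` U) c (inv_into U c)" and U: "open U" and cU: "open (c ` U)"
    by (auto simp: is_chart_def)
  then show "open U" "open (c ` U)" "q \<in> U \<Longrightarrow> inv_into U c (c q) = q"
    "continuous_on (c ` U) (inv_into U c)"
    by (auto simp: homeomorphism_def)
  assume "open V"
  then have "openin (top_of_set U) (U \<inter> V)" by (simp add: openin_open_Int)
  then have "openin (top_of_set (c ` U)) (c ` (U \<inter> V))"
    by (rule homeomorphism_imp_open_map[OF hom])
  then show "open (c ` (U \<inter> V))" using cU by (simp add: openin_open_eq)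
qed

lemma smooth_functionsD:
  "f \<in> smooth_functions A \<Longrightarrow> (U, c) \<in> A \<Longrightarrow> Cinf_on (f \<circ> inv_into U c) (c ` U)"
  by (auto simp: smooth_functions_def)

lemma smooth_const: "(\<lambda>q. k) \<in> smooth_functions A"
  using open_chart_image by (auto simp: smooth_functions_def comp_def Cinf_on_const)

lemma smooth_add:
  "f \<in> smooth_functions A \<Longrightarrow> h \<in> smooth_functions A \<Longrightarrow> (\<lambda>q. f q + h q) \<in> smooth_functions A"
  using open_chart_image by (auto simp: smooth_functions_def comp_def intro!: Cinf_on_add)

lemma smooth_mult:
  "f \<in> smooth_functions A \<Longrightarrow> h \<in> smooth_functions A \<Longrightarrow> (\<lambda>q. f q * h q) \<in> smooth_functions A"
  using open_chart_image by (auto simp: smooth_functions_def comp_def intro!: Cinf_on_mult)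

lemma smooth_combination:
  "f \<in> smooth_functions A \<Longrightarrow> h \<in> smooth_functions A
    \<Longrightarrow> (\<lambda>q. a * f q + b * h q) \<in> smooth_functions A"
  by (intro smooth_add smooth_mult smooth_const)

lemma smooth_diff:
  "f \<in> smooth_functions A \<Longrightarrow> h \<in> smooth_functions A \<Longrightarrow> (\<lambda>q. f q - h q) \<in> smooth_functions A"
  using open_chart_image by (auto simp: smooth_functions_def comp_def intro!: Cinf_on_diff)

lemma smooth_sum:
  "(\<And>i. i \<in> I \<Longrightarrow> f i \<in> smooth_functions A) \<Longrightarrow> (\<lambda>q. \<Sum>i\<in>I. f i q) \<in> smooth_functions A"
proof (induction I rule: infinite_finite_induct)
  case (insert i I)
  then show ?case by (simp add: smooth_add)
qed (simp_all add: smooth_const)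

text \<open>Near a point outside \<open>U\<close> the extension vanishes: the preimage of \<open>K\<close> in the manifold is compact,
  hence closed because the manifold is Hausdorff, and it does not contain that point.\<close>

lemma smooth_extension_by_zero:
  assumes chart: "(U, c) \<in> A" and w: "Cinf_on w (c ` U)"
    and K: "compact K" "K \<subseteq> c ` U" and zero: "\<And>x. x \<in> c ` U - K \<Longrightarrow> w x = 0"
  shows "(\<lambda>q. if q \<in> U then w (c q) else 0) \<in> smooth_functions A"
proof -
  let ?F = "\<lambda>q. if q \<in> U then w (c q) else 0"
  have "Cinf_on (?F \<circ> inv_into V d) (d ` V)" if chart': "(V, d) \<in> A" for V d
  proof (rule Cinf_on_local)
    fix y assume "y \<in> d ` V"
    then obtain q where q: "q \<in> V" "y = d q" by blast
    show "\<exists>T. open T \<and> y \<in> T \<and> T \<subseteq> d ` V \<and> Cinf_on (?F \<circ> inv_into V d) T"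
    proof (cases "q \<in> U")
      case True
      let ?T = "d ` (V \<inter> U)"
      have T: "open ?T"
        by (rule open_chart_image_of_open[OF chart' open_chart_domain[OF chart]])
      have "Cinf_on (c \<circ> inv_into V d) ?T"
        using compatible[OF chart' chart] by (simp add: smooth_compatible_def)
      then have "Cinf_on (\<lambda>x. w ((c \<circ> inv_into V d) x)) ?T"
        by (intro Cinf_on_compose[OF T open_chart_image[OF chart] _ _ w])
           (auto simp: chart_inverse[OF chart'] comp_def)
      then have "Cinf_on (?F \<circ> inv_into V d) ?T"
        by (rule Cinf_on_cong[OF T, rotated]) (auto simp: chart_inverse[OF chart'])
      with T q True show ?thesis by blast
    next
      case False
      let ?K = "inv_into U c ` K"
      have "compact ?K"
        using K continuous_on_chart_inverse[OF chart] by (meson compact_continuous_image continuous_on_subset)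
      then have "open (- ?K)" by (simp add: compact_imp_closed open_Compl)
      let ?T = "d ` (V \<inter> - ?K)"
      have T: "open ?T" by (rule open_chart_image_of_open[OF chart' \<open>open (- ?K)\<close>])
      have F0: "?F s = 0" if s: "s \<notin> ?K" for s
      proof (cases "s \<in> U")
        case True
        then have "c s \<notin> K" using s chart_inverse[OF chart True] by (auto simp: image_iff)
        then show ?thesis using zero[of "c s"] True by simp
      qed simp
      have "0 = (?F \<circ> inv_into V d) x" if x: "x \<in> ?T" for x
      proof -
        obtain s where "s \<in> V" "s \<notin> ?K" "x = d s" using x by blast
        then have "(?F \<circ> inv_into V d) x = ?F s" using chart_inverse[OF chart', of s] by simp
        also have "\<dots> = 0" using \<open>s \<notin> ?K\<close> by (rule F0)
        finally show ?thesis by simp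
      qed
      then have "Cinf_on (?F \<circ> inv_into V d) ?T"
        by (rule Cinf_on_cong[OF T _ Cinf_on_const[OF T]])
      moreover have "q \<notin> ?K"
      proof
        assume "q \<in> ?K"
        then obtain x where "x \<in> K" "q = inv_into U c x" by blast
        then show False using False inv_into_into[OF subsetD[OF K(2)], of x] by simp
      qed
      ultimately show ?thesis using T q by blast
    qed
  qed
  then show ?thesis by (auto simp: smooth_functions_def)
qed

lemma tangent_combination:
  assumes "v \<in> tangent_space A p" "f \<in> smooth_functions A" "h \<in> smooth_functions A"
  shows "v (\<lambda>x. a * f x + b * h x) = a * v f + b * v h"
  using assms by (auto simp: tangent_space_def)

lemma tangent_add:
  assumes "v \<in> tangent_space A p" "f \<in> smooth_functions A" "h \<in> smooth_functions A"
  shows "v (\<lambda>x. f x + h x) = v f + v h"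
  using tangent_combination[OF assms, of 1 1] by simp

lemma tangent_diff:
  assumes "v \<in> tangent_space A p" "f \<in> smooth_functions A" "h \<in> smooth_functions A"
  shows "v (\<lambda>x. f x - h x) = v f - v h"
  using tangent_combination[OF assms, of 1 "-1"] by simp

lemma tangent_mult:
  assumes "v \<in> tangent_space A p" "f \<in> smooth_functions A" "h \<in> smooth_functions A"
  shows "v (\<lambda>x. f x * h x) = v f * h p + f p * v h"
  using assms by (auto simp: tangent_space_def)

lemma tangent_not_smooth:
  assumes "v \<in> tangent_space A p" "f \<notin> smooth_functions A"
  shows "v f = 0"
  using assms by (auto simp: tangent_space_def)

text \<open>By the Leibniz rule, a derivation takes the value \<open>2 v(1)\<close> on \<open>1 = 1 * 1\<close>.\<close>

lemma tangent_const:
  assumes "v \<in> tangent_space A p"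
  shows "v (\<lambda>x. k) = 0"
  using tangent_mult[OF assms smooth_const[of 1] smooth_const[of 1]]
    tangent_combination[OF assms smooth_const[of 1] smooth_const[of 1], of k 0]
  by simp

lemma tangent_cmult:
  assumes "v \<in> tangent_space A p" "f \<in> smooth_functions A"
  shows "v (\<lambda>x. k * f x) = k * v f"
  using tangent_mult[OF assms(1) smooth_const[of k] assms(2)] tangent_const[OF assms(1)] by simp

lemma tangent_sum:
  assumes "v \<in> tangent_space A p" "\<And>i. i \<in> I \<Longrightarrow> f i \<in> smooth_functions A"
  shows "v (\<lambda>x. \<Sum>i\<in>I. f i x) = (\<Sum>i\<in>I. v (f i))"
  using assms(2)
proof (induction I rule: infinite_finite_induct)
  case (insert i I)
  then show ?case by (simp add: tangent_add[OF assms(1)] smooth_sum)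
qed (simp_all add: tangent_const[OF assms(1)])

text \<open>The value on functions that are not smooth is the one that tangent vectors are required to have.\<close>

definition coord_vec :: "'m set \<Rightarrow> ('m \<Rightarrow> 'e) \<Rightarrow> 'm \<Rightarrow> 'e \<Rightarrow> 'm tvec"
  where "coord_vec U c q w = (\<lambda>f. if f \<in> smooth_functions A
    then frechet_derivative (f \<circ> inv_into U c) (at (c q)) w else 0)"

lemma chart_has_derivative:
  assumes "(U, c) \<in> A" "q \<in> U" "f \<in> smooth_functions A"
  shows "((f \<circ> inv_into U c) has_derivative frechet_derivative (f \<circ> inv_into U c) (at (c q))) (at (c q))"
  using Cinf_on_has_derivative[OF open_chart_image[OF assms(1)] smooth_functionsD[OF assms(3,1)]]
    assms(2) by blast

lemma coord_vec_tangent: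
  assumes "(U, c) \<in> A" "q \<in> U"
  shows "coord_vec U c q w \<in> tangent_space A q"
proof -
  note D = chart_has_derivative[OF assms]
  have "frechet_derivative ((\<lambda>x. a * f x + b * h x) \<circ> inv_into U c) (at (c q))
    = (\<lambda>w. a * frechet_derivative (f \<circ> inv_into U c) (at (c q)) w + b * frechet_derivative (h \<circ> inv_into U c) (at (c q)) w)"
    if "f \<in> smooth_functions A" "h \<in> smooth_functions A" for f h a b
    using has_derivative_add[OF has_derivative_mult_right[OF D[OF that(1)], of a] has_derivative_mult_right[OF D[OF that(2)], of b]]
    by (intro frechet_derivative_at[symmetric]) (simp add: comp_def)
  moreover have "frechet_derivative ((\<lambda>x. f x * h x) \<circ> inv_into U c) (at (c q))
    = (\<lambda>w. f q * frechet_derivative (h \<circ> inv_into U c) (at (c q)) w + frechet_derivative (f \<circ> inv_into U c) (at (c q)) w * h q)"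
    if "f \<in> smooth_functions A" "h \<in> smooth_functions A" for f h
    using has_derivative_mult[OF D[OF that(1)] D[OF that(2)]]
    by (intro frechet_derivative_at[symmetric]) (simp add: comp_def chart_inverse[OF assms])
  ultimately show ?thesis
    by (auto simp: tangent_space_def coord_vec_def smooth_mult smooth_combination)
qed

lemma linear_coord_vec:
  assumes "(U, c) \<in> A" "q \<in> U"
  shows "linear (coord_vec U c q)"
proof -
  note l = has_derivative_linear[OF chart_has_derivative[OF assms]]
  show ?thesis
    by (rule linearI)
       (auto simp: coord_vec_def fun_eq_iff scaleR_fun_def linear_add[OF l] linear_scale[OF l])
qed

end


locale centred_chart = smooth_manifold A
  for A :: "('m::{t2_space, second_countable_topology}, 'e::euclidean_space) chart set" +
  fixes U :: "'m set" and c :: "'m \<Rightarrow> 'e" and p :: 'm and R :: real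
  assumes chart: "(U, c) \<in> A" and centre: "p \<in> U" and R_pos: "R > 0"
    and ball_in_image: "ball (c p) R \<subseteq> c ` U"
begin

definition nbhd :: "'m set"
  where "nbhd = {q \<in> U. c q \<in> ball (c p) R}"

abbreviation \<beta> :: "'e \<Rightarrow> real"
  where "\<beta> \<equiv> bump (c p) (R / 2)"

text \<open>Carries a function near the centre of the chart to a global function on the manifold with the
  same value at \<open>p\<close>, after multiplication by the bump function.\<close>

definition localize :: "('e \<Rightarrow> real) \<Rightarrow> 'm \<Rightarrow> real"
  where "localize g = (\<lambda>q. if q \<in> nbhd then \<beta> (c q) * g (c q) else 0)"

lemma smooth_localize:
  assumes "Cinf_on g (ball (c p) R)"
  shows "localize g \<in> smooth_functions A"
proof -
  \<comment> \<open>The factor \<open>g\<close> is smooth only on the ball, which contains the support of the bump function.\<close>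
  let ?w = "\<lambda>x. if x \<in> ball (c p) R then \<beta> x * g x else 0" and ?K = "cball (c p) (R / 2)"
  have K: "?K \<subseteq> ball (c p) R" using R_pos by auto
  have zero: "?w x = 0" if "x \<notin> ?K" for x
    using that R_pos bump_outside[of x "c p" "R / 2"] by simp
  have 1: "Cinf_on ?w (ball (c p) R)"
    by (rule Cinf_on_cong[OF open_ball _ Cinf_on_mult[OF open_ball Cinf_on_subset[OF Cinf_on_bump[of "c p" "R / 2"] subset_UNIV] assms]]) simp
  have 2: "Cinf_on ?w (- ?K)"
    by (rule Cinf_on_cong[of _ "\<lambda>x. 0"]) (use zero in \<open>auto intro: Cinf_on_const\<close>)
  have "Cinf_on ?w UNIV"
  proof (rule Cinf_on_local)
    fix x :: 'e
    show "\<exists>T. open T \<and> x \<in> T \<and> T \<subseteq> UNIV \<and> Cinf_on ?w T"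
    proof (cases "x \<in> ball (c p) R")
      case True
      then show ?thesis using 1 open_ball by blast
    next
      case False
      then have "x \<in> - ?K" using K by blast
      moreover have "open (- ?K)" by (simp add: open_Compl)
      ultimately show ?thesis using 2 by blast
    qed
  qed
  then have "Cinf_on ?w (c ` U)" using Cinf_on_subset by blast
  then have "(\<lambda>q. if q \<in> U then ?w (c q) else 0) \<in> smooth_functions A"
  proof (rule smooth_extension_by_zero[OF chart _ compact_cball])
    show "?K \<subseteq> c ` U" using K ball_in_image by blast
    show "?w x = 0" if "x \<in> c ` U - ?K" for x
      using that by (intro zero) blast
  qed
  moreover have "(\<lambda>q. if q \<in> U then ?w (c q) else 0) = localize g"
    by (auto simp: localize_def nbhd_def fun_eq_iff)
  ultimately show ?thesis by simp
qed

lemma centre_in_nbhd: "p \<in> nbhd"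
  using centre R_pos by (simp add: nbhd_def)

lemma nbhd_subset: "nbhd \<subseteq> U"
  by (auto simp: nbhd_def)

lemma localize_centre: "localize g p = g (c p)"
  using centre_in_nbhd R_pos by (simp add: localize_def bump_centre)

lemma coord_vec_localize:
  assumes q: "q \<in> nbhd" and g: "Cinf_on g (ball (c p) R)"
  shows "coord_vec U c q w (localize g) =
    frechet_derivative \<beta> (at (c q)) w * g (c q) + \<beta> (c q) * frechet_derivative g (at (c q)) w"
proof -
  have cq: "c q \<in> ball (c p) R" using q by (simp add: nbhd_def)
  have "(localize g \<circ> inv_into U c) x = \<beta> x * g x" if x: "x \<in> ball (c p) R" for x
  proof -
    obtain s where "s \<in> U" "x = c s" using x ball_in_image by blast
    then show ?thesis using x chart_inverse[OF chart] by (simp add: localize_def nbhd_def)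
  qed
  then have "frechet_derivative (localize g \<circ> inv_into U c) (at (c q))
      = frechet_derivative (\<lambda>x. \<beta> x * g x) (at (c q))"
    by (rule frechet_derivative_cong_open[OF open_ball cq])
  also have "\<dots> = (\<lambda>w. \<beta> (c q) * frechet_derivative g (at (c q)) w + frechet_derivative \<beta> (at (c q)) w * g (c q))"
    by (rule frechet_derivative_at[symmetric],
        rule has_derivative_mult[OF Cinf_on_has_derivative[OF open_UNIV Cinf_on_bump UNIV_I]
          Cinf_on_has_derivative[OF open_ball g cq]])
  finally show ?thesis using smooth_localize[OF g] by (simp add: coord_vec_def)
qed

text \<open>Write \<open>\<rho>\<close> for the bump function and let \<open>f = f(p) + \<Sum> x\<^sub>b g\<^sub>b\<close> be Hadamard's expansion in the chart.
  Multiplied by \<open>\<rho>\<^sup>2\<close> it reads \<open>\<rho>\<^sup>2 f = f(p) \<rho>\<^sup>2 + \<Sum> (\<rho> x\<^sub>b) (\<rho> g\<^sub>b)\<close>, an identity between globally smooth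
  functions, and the derivation can be applied to it. As \<open>\<rho>(p) = 1\<close> and \<open>x\<^sub>b(p) = 0\<close>, what is left is
  \<open>v f = \<Sum> v(\<rho> x\<^sub>b) \<partial>\<^sub>b f\<close>.\<close>

lemma tangent_at_centre:
  assumes v: "v \<in> tangent_space A p"
  shows "v \<in> range (coord_vec U c p)"
proof (rule range_eqI, rule ext)
  fix f
  let ?X = "\<lambda>b. localize (\<lambda>x. (x - c p) \<bullet> b)"
  show "v f = coord_vec U c p (\<Sum>b\<in>Basis. v (?X b) *\<^sub>R b) f"
  proof (cases "f \<in> smooth_functions A")
    case False
    then show ?thesis using tangent_not_smooth[OF v] by (simp add: coord_vec_def)
  next
    case f: True
    let ?u = "f \<circ> inv_into U c" and ?\<rho> = "localize (\<lambda>x. 1)"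
    have u: "Cinf_on ?u (ball (c p) R)"
      using Cinf_on_subset[OF smooth_functionsD[OF f chart] ball_in_image] .
    obtain g where g: "\<And>b. Cinf_on (g b) (ball (c p) R)"
        and g0: "\<And>b. g b (c p) = frechet_derivative ?u (at (c p)) b"
        and eq: "\<And>x. x \<in> ball (c p) R \<Longrightarrow> ?u x = ?u (c p) + (\<Sum>b\<in>Basis. ((x - c p) \<bullet> b) * g b x)"
      using Hadamard[OF u] by blast
    have \<rho>: "?\<rho> \<in> smooth_functions A" by (intro smooth_localize Cinf_on_const open_ball)
    have X: "?X b \<in> smooth_functions A" for b by (intro smooth_localize Cinf_on_coordinate)
    have G: "localize (g b) \<in> smooth_functions A" for b by (intro smooth_localize g)
    have \<rho>2: "(\<lambda>q. ?\<rho> q * ?\<rho> q) \<in> smooth_functions A" by (intro smooth_mult \<rho>)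
    \<comment> \<open>Both sides vanish outside the neighbourhood of \<open>p\<close> on which Hadamard's expansion holds.\<close>
    have expansion: "(\<lambda>q. (?\<rho> q * ?\<rho> q) * f q)
        = (\<lambda>q. f p * (?\<rho> q * ?\<rho> q) + (\<Sum>b\<in>Basis. ?X b q * localize (g b) q))"
    proof
      fix q
      show "(?\<rho> q * ?\<rho> q) * f q
        = f p * (?\<rho> q * ?\<rho> q) + (\<Sum>b\<in>Basis. ?X b q * localize (g b) q)"
      proof (cases "q \<in> nbhd")
        case True
        then have "f q = f p + (\<Sum>b\<in>Basis. ((c q - c p) \<bullet> b) * g b (c q))"
          using eq[of "c q"] nbhd_subset centre by (auto simp: nbhd_def chart_inverse[OF chart])
        with True show ?thesis
          by (simp add: localize_def algebra_simps sum_distrib_left)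
      qed (simp add: localize_def)
    qed
    have "v f = v (\<lambda>q. (?\<rho> q * ?\<rho> q) * f q) - f p * v (\<lambda>q. ?\<rho> q * ?\<rho> q)"
      using tangent_mult[OF v \<rho>2 f] by (simp add: localize_centre)
    also have "v (\<lambda>q. (?\<rho> q * ?\<rho> q) * f q)
        = f p * v (\<lambda>q. ?\<rho> q * ?\<rho> q) + (\<Sum>b\<in>Basis. v (\<lambda>q. ?X b q * localize (g b) q))"
      unfolding expansion
      by (simp add: tangent_add[OF v] tangent_cmult[OF v] tangent_sum[OF v] smooth_mult smooth_sum smooth_const \<rho> X G)
    also have "\<dots> - f p * v (\<lambda>q. ?\<rho> q * ?\<rho> q)
        = (\<Sum>b\<in>Basis. v (?X b) * frechet_derivative ?u (at (c p)) b)"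
      by (simp add: tangent_mult[OF v X G] localize_centre g0)
    also have "\<dots> = frechet_derivative ?u (at (c p)) (\<Sum>b\<in>Basis. v (?X b) *\<^sub>R b)"
      using has_derivative_linear[OF chart_has_derivative[OF chart centre f]]
      by (simp add: linear_sum linear_scale)
    finally show ?thesis using f by (simp add: coord_vec_def)
  qed
qed

text \<open>The localized coordinate functions recover the components of the direction.\<close>

lemma inj_coord_vec_centre: "inj (coord_vec U c p)"
proof (rule injI)
  fix w w' assume eq: "coord_vec U c p w = coord_vec U c p w'"
  have X: "coord_vec U c p z (localize (\<lambda>x. (x - c p) \<bullet> b)) = z \<bullet> b" for z b
    using R_pos by (simp add: coord_vec_localize centre_in_nbhd Cinf_on_coordinate
        frechet_derivative_coordinate bump_centre)
  have "w \<bullet> b = w' \<bullet> b" for b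
    using X[of w b] X[of w' b] eq by simp
  then show "w = w'" by (rule euclidean_eqI)
qed

end

context smooth_manifold
begin

lemma centred_chart_at:
  assumes "(U, c) \<in> A" "q \<in> U"
  obtains R where "centred_chart A U c q R"
proof -
  obtain R where "R > 0" "ball (c q) R \<subseteq> c ` U"
    using open_chart_image[OF assms(1)] assms(2) by (metis imageI open_contains_ball)
  then have "centred_chart A U c q R"
    using assms by unfold_locales auto
  then show thesis by (rule that)
qed

lemma centred_chart_exists:
  obtains U c R where "centred_chart A U c q R"
proof -
  obtain U c where "(U, c) \<in> A" "q \<in> U"
    using covering by fastforce
  then obtain R where "centred_chart A U c q R" by (rule centred_chart_at)
  then show thesis by (rule that)
qed

lemma tangent_space_eq_coord_vecs:
  assumes "(U, c) \<in> A" "q \<in> U"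
  shows "tangent_space A q = range (coord_vec U c q)"
proof -
  obtain R where "centred_chart A U c q R" using centred_chart_at[OF assms] .
  then have "tangent_space A q \<subseteq> range (coord_vec U c q)"
    using centred_chart.tangent_at_centre by blast
  moreover have "range (coord_vec U c q) \<subseteq> tangent_space A q"
    by (rule image_subsetI) (rule coord_vec_tangent[OF assms])
  ultimately show ?thesis by (rule equalityI)
qed

lemma subspace_tangent_space: "subspace (tangent_space A q)"
proof -
  obtain U c R where "centred_chart A U c q R" by (rule centred_chart_exists)
  then interpret centred_chart A U c q R .
  show ?thesis
    using linear_subspace_image[OF linear_coord_vec[OF chart centre] subspace_UNIV]
    by (simp only: tangent_space_eq_coord_vecs[OF chart centre])
qed

lemma dim_tangent_space: "dim (tangent_space A q) = DIM('e)"
proof -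
  obtain U c R where "centred_chart A U c q R" by (rule centred_chart_exists)
  then interpret centred_chart A U c q R .
  note l = linear_coord_vec[OF chart centre]
  let ?B = "coord_vec U c q ` Basis"
  have "independent ?B"
    using linear_independent_injective_image[OF l independent_Basis] inj_coord_vec_centre by auto
  moreover have "span ?B = tangent_space A q"
    by (simp add: linear_span_image[OF l] tangent_space_eq_coord_vecs[OF chart centre])
  moreover have "card ?B = DIM('e)"
    using inj_coord_vec_centre by (simp add: card_image inj_on_subset)
  ultimately show ?thesis
    by (metis dim_eq_card_independent dim_span)
qed

lemma finite_dim_tangent_space:
  obtains B where "finite B" "span B = tangent_space A q"
proof -
  obtain U c R where "centred_chart A U c q R" by (rule centred_chart_exists)
  then interpret centred_chart A U c q R .
  show ?thesis
    by (rule that[of "coord_vec U c q ` Basis"])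
       (simp_all add: linear_span_image[OF linear_coord_vec[OF chart centre]]
          tangent_space_eq_coord_vecs[OF chart centre])
qed

lemma vector_fieldD:
  assumes "X \<in> vector_fields A"
  shows "X q \<in> tangent_space A q"
    and "f \<in> smooth_functions A \<Longrightarrow> (\<lambda>q. X q f) \<in> smooth_functions A"
  using assms by (auto simp: vector_fields_def)

lemma vector_field_add:
  assumes "X \<in> vector_fields A" "Y \<in> vector_fields A"
  shows "X + Y \<in> vector_fields A"
  using vector_fieldD[OF assms(1)] vector_fieldD[OF assms(2)] subspace_add[OF subspace_tangent_space]
  by (auto simp: vector_fields_def intro: smooth_add)

lemma vector_field_scale:
  assumes "f \<in> smooth_functions A" "X \<in> vector_fields A"
  shows "scale_field f X \<in> vector_fields A"
  using vector_fieldD[OF assms(2)] assms(1) subspace_scale[OF subspace_tangent_space]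
  by (auto simp: vector_fields_def scale_field_def scaleR_fun_def[where 'a = "'m \<Rightarrow> real"] intro: smooth_mult)

lemma vector_field_zero: "0 \<in> vector_fields A"
  using subspace_0[OF subspace_tangent_space] smooth_const
  by (auto simp: vector_fields_def zero_fun_def)

lemma scale_field_minus_one: "scale_field (\<lambda>q. -1) X = - X"
  by (simp add: scale_field_def fun_eq_iff)

lemma vector_field_minus: "X \<in> vector_fields A \<Longrightarrow> - X \<in> vector_fields A"
  using vector_field_scale[OF smooth_const[of "-1"]] by (simp add: scale_field_minus_one)

lemma vector_field_diff: "X \<in> vector_fields A \<Longrightarrow> Y \<in> vector_fields A \<Longrightarrow> X - Y \<in> vector_fields A"
  using vector_field_add[OF _ vector_field_minus, of X Y] by simp

lemma vector_field_sum:
  "(\<And>i. i \<in> I \<Longrightarrow> X i \<in> vector_fields A) \<Longrightarrow> (\<Sum>i\<in>I. X i) \<in> vector_fields A"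
  by (induction I rule: infinite_finite_induct) (auto simp: vector_field_zero vector_field_add)

end

lemma sum_fun_at: "(\<Sum>i\<in>I. X i) q = (\<Sum>i\<in>I. X i q)"
  by (induction I rule: infinite_finite_induct) auto

context centred_chart
begin

definition local_field :: "'e \<Rightarrow> 'm vfield"
  where "local_field w = (\<lambda>q. localize (\<lambda>x. 1) q *\<^sub>R coord_vec U c q w)"

lemma local_field_vector_field: "local_field w \<in> vector_fields A"
proof -
  have "local_field w q \<in> tangent_space A q" for q
  proof (cases "q \<in> nbhd")
    case True
    then show ?thesis
      using coord_vec_tangent[OF chart] nbhd_subset subspace_scale[OF subspace_tangent_space]
      by (auto simp: local_field_def)
  next
    case False
    then show ?thesis
      using subspace_0[OF subspace_tangent_space] by (simp add: local_field_def localize_def)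
  qed
  moreover have "(\<lambda>q. local_field w q f) \<in> smooth_functions A" if f: "f \<in> smooth_functions A" for f
  proof -
    have "(\<lambda>q. local_field w q f) = localize (\<lambda>x. frechet_derivative (f \<circ> inv_into U c) (at x) w)"
      using f by (auto simp: local_field_def localize_def coord_vec_def scaleR_fun_def)
    then show ?thesis
      using Cinf_on_directional_derivative[OF Cinf_on_subset[OF smooth_functionsD[OF f chart] ball_in_image]]
      by (simp add: smooth_localize)
  qed
  ultimately show ?thesis by (simp add: vector_fields_def)
qed

lemma local_field_centre: "local_field w p = coord_vec U c p w"
  by (simp add: local_field_def localize_centre)

text \<open>On the chart \<open>X = \<Sum> w\<^sub>b \<partial>\<^sub>b\<close>. The components \<open>w\<^sub>b\<close> are only defined there, but by the product rule
  \<open>\<rho> X(\<rho> x\<^sub>b) - \<rho> x\<^sub>b X(\<rho>) = \<rho>\<^sup>2 w\<^sub>b\<close>, whose left-hand side is a smooth function on the whole manifold.\<close>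

lemma vector_field_expansion:
  assumes X: "X \<in> vector_fields A"
  defines "\<rho> \<equiv> localize (\<lambda>x. 1)" and "\<psi> \<equiv> \<lambda>b. localize (\<lambda>x. (x - c p) \<bullet> b)"
  shows "scale_field (\<lambda>q. \<rho> q * (\<rho> q * \<rho> q)) X
    = (\<Sum>b\<in>Basis. scale_field (\<lambda>q. \<rho> q * X q (\<psi> b) - \<psi> b q * X q \<rho>) (local_field b))"
proof
  fix q
  have "(\<rho> q * (\<rho> q * \<rho> q)) *\<^sub>R X q
    = (\<Sum>b\<in>Basis. (\<rho> q * X q (\<psi> b) - \<psi> b q * X q \<rho>) *\<^sub>R local_field b q)"
  proof (cases "q \<in> nbhd")
    case True
    then have "q \<in> U" using nbhd_subset by blast
    then obtain w where w: "X q = coord_vec U c q w"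
      using vector_fieldD(1)[OF X, of q] tangent_space_eq_coord_vecs[OF chart] by blast
    note l = linear_coord_vec[OF chart \<open>q \<in> U\<close>]
    have X\<psi>: "X q (\<psi> b) = frechet_derivative \<beta> (at (c q)) w * ((c q - c p) \<bullet> b) + \<beta> (c q) * (w \<bullet> b)" for b
      unfolding w \<psi>_def coord_vec_localize[OF True Cinf_on_coordinate] frechet_derivative_coordinate ..
    have X\<rho>: "X q \<rho> = frechet_derivative \<beta> (at (c q)) w"
      unfolding w \<rho>_def coord_vec_localize[OF True Cinf_on_const[OF open_ball]] frechet_derivative_const
      by simp
    have at_q: "\<rho> q = \<beta> (c q)" "\<psi> b q = \<beta> (c q) * ((c q - c p) \<bullet> b)" for b
      unfolding \<rho>_def \<psi>_def localize_def using True by simp_all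
    have "\<rho> q * X q (\<psi> b) - \<psi> b q * X q \<rho> = (\<rho> q * \<rho> q) * (w \<bullet> b)" for b
      unfolding X\<psi> X\<rho> at_q by (simp add: algebra_simps)
    then have "(\<Sum>b\<in>Basis. (\<rho> q * X q (\<psi> b) - \<psi> b q * X q \<rho>) *\<^sub>R local_field b q)
        = (\<Sum>b\<in>Basis. ((\<rho> q * \<rho> q) * (w \<bullet> b)) *\<^sub>R (\<rho> q *\<^sub>R coord_vec U c q b))"
      by (simp only: local_field_def \<rho>_def)
    also have "\<dots> = (\<rho> q * (\<rho> q * \<rho> q)) *\<^sub>R (\<Sum>b\<in>Basis. (w \<bullet> b) *\<^sub>R coord_vec U c q b)"
      unfolding scaleR_sum_right by (intro sum.cong refl) (simp only: scaleR_scaleR mult_ac)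
    also have "(\<Sum>b\<in>Basis. (w \<bullet> b) *\<^sub>R coord_vec U c q b) = X q"
    proof -
      have "coord_vec U c q (\<Sum>b\<in>Basis. (w \<bullet> b) *\<^sub>R b) = (\<Sum>b\<in>Basis. (w \<bullet> b) *\<^sub>R coord_vec U c q b)"
        by (simp only: linear_sum[OF l] linear_scale[OF l])
      then show ?thesis by (simp only: w euclidean_representation)
    qed
    finally show ?thesis by simp
  next
    case False
    then show ?thesis by (simp add: \<rho>_def local_field_def localize_def)
  qed
  then show "scale_field (\<lambda>q. \<rho> q * (\<rho> q * \<rho> q)) X q
    = (\<Sum>b\<in>Basis. scale_field (\<lambda>q. \<rho> q * X q (\<psi> b) - \<psi> b q * X q \<rho>) (local_field b)) q"
    by (simp add: scale_field_def sum_fun_at)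
qed

end

context smooth_manifold
begin

lemma extend_vec:
  assumes "v \<in> tangent_space A q"
  shows "extend_vec A q v \<in> vector_fields A" "extend_vec A q v q = v"
proof -
  obtain U c R where "centred_chart A U c q R" by (rule centred_chart_exists)
  then interpret centred_chart A U c q R .
  obtain w where "v = coord_vec U c q w"
    using assms tangent_space_eq_coord_vecs[OF chart centre] by blast
  then have "local_field w \<in> vector_fields A \<and> local_field w q = v"
    by (simp add: local_field_vector_field local_field_centre)
  then have "\<exists>X. X \<in> vector_fields A \<and> X q = v" by (intro exI[of _ "local_field w"])
  from someI_ex[OF this] show "extend_vec A q v \<in> vector_fields A" "extend_vec A q v q = v"
    by (simp_all add: extend_vec_def)
qed

text \<open>The coefficients in the expansion of \<open>X\<close> by the local fields vanish wherever \<open>X\<close> does, and the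
  factor \<open>\<rho>\<^sup>3\<close> is one at the point.\<close>

lemma tensorial_vanishes:
  fixes T :: "'m vfield \<Rightarrow> 'm vfield"
  assumes add: "\<And>X Y. X \<in> vector_fields A \<Longrightarrow> Y \<in> vector_fields A \<Longrightarrow> T (X + Y) = T X + T Y"
    and scale: "\<And>f X. f \<in> smooth_functions A \<Longrightarrow> X \<in> vector_fields A \<Longrightarrow> T (scale_field f X) = scale_field f (T X)"
    and X: "X \<in> vector_fields A" "X q = 0"
  shows "T X q = 0"
proof -
  obtain U c R where "centred_chart A U c q R" by (rule centred_chart_exists)
  then interpret centred_chart A U c q R .
  let ?\<rho> = "localize (\<lambda>x. 1)" and ?\<psi> = "\<lambda>b. localize (\<lambda>x. (x - c q) \<bullet> b)"
  let ?f = "\<lambda>b q. ?\<rho> q * X q (?\<psi> b) - ?\<psi> b q * X q ?\<rho>"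
  have \<rho>: "?\<rho> \<in> smooth_functions A" by (intro smooth_localize Cinf_on_const open_ball)
  have \<psi>: "?\<psi> b \<in> smooth_functions A" for b by (intro smooth_localize Cinf_on_coordinate)
  have f: "?f b \<in> smooth_functions A" for b
    by (intro smooth_diff smooth_mult \<rho> \<psi> vector_fieldD(2)[OF X(1)])
  have T0: "T 0 = 0"
    using add[OF vector_field_zero vector_field_zero] by simp
  have T_sum: "T (\<Sum>b\<in>I. Z b) = (\<Sum>b\<in>I. T (Z b))" if "\<And>b. Z b \<in> vector_fields A" for I :: "'e set" and Z
  proof (induction I rule: infinite_finite_induct)
    case (insert b I)
    then show ?case
      by (simp only: sum.insert add[OF that vector_field_sum[OF that]] simp_thms)
  qed (simp_all only: sum.infinite sum.empty T0 not_False_eq_True)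
  have "T (scale_field (\<lambda>q. ?\<rho> q * (?\<rho> q * ?\<rho> q)) X)
      = (\<Sum>b\<in>Basis. T (scale_field (?f b) (local_field b)))"
    unfolding vector_field_expansion[OF X(1)]
    by (intro T_sum vector_field_scale f local_field_vector_field)
  also have "\<dots> = (\<Sum>b\<in>Basis. scale_field (?f b) (T (local_field b)))"
    by (intro sum.cong refl scale f local_field_vector_field)
  finally have "T (scale_field (\<lambda>q. ?\<rho> q * (?\<rho> q * ?\<rho> q)) X)
      = (\<Sum>b\<in>Basis. scale_field (?f b) (T (local_field b)))" .
  moreover have "T (scale_field (\<lambda>q. ?\<rho> q * (?\<rho> q * ?\<rho> q)) X) = scale_field (\<lambda>q. ?\<rho> q * (?\<rho> q * ?\<rho> q)) (T X)"
    by (intro scale smooth_mult \<rho> X)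
  ultimately have "scale_field (\<lambda>q. ?\<rho> q * (?\<rho> q * ?\<rho> q)) (T X) q
      = (\<Sum>b\<in>Basis. scale_field (?f b) (T (local_field b)) q)"
    by (simp add: sum_fun_at)
  also have "\<dots> = 0"
  proof (intro sum.neutral ballI)
    fix b :: 'e
    have "?f b q = 0" using X(2) by simp
    then show "scale_field (?f b) (T (local_field b)) q = 0"
      by (simp only: scale_field_def scaleR_zero_left)
  qed
  finally show ?thesis
    by (simp only: scale_field_def localize_centre mult_1 scaleR_one)
qed

lemma tensorial_pointwise:
  fixes T :: "'m vfield \<Rightarrow> 'm vfield"
  assumes add: "\<And>X Y. X \<in> vector_fields A \<Longrightarrow> Y \<in> vector_fields A \<Longrightarrow> T (X + Y) = T X + T Y"
    and scale: "\<And>f X. f \<in> smooth_functions A \<Longrightarrow> X \<in> vector_fields A \<Longrightarrow> T (scale_field f X) = scale_field f (T X)"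
    and "X \<in> vector_fields A" "Y \<in> vector_fields A" "X q = Y q"
  shows "T X q = T Y q"
proof -
  have "T (X - Y) q = 0"
    by (rule tensorial_vanishes[of T, OF add scale vector_field_diff[OF assms(3,4)]])
       (use assms(5) in auto)
  moreover have "T X = T (X - Y) + T Y"
    using add[OF vector_field_diff[OF assms(3,4)] assms(4)] by simp
  ultimately show ?thesis by simp
qed

end

section \<open>Traces and nondegenerate symmetric forms\<close>

lemma linear_map_onD:
  assumes "linear_map_on V T" "subspace V"
  shows linear_map_on_add: "x \<in> V \<Longrightarrow> y \<in> V \<Longrightarrow> T (x + y) = T x + T y"
    and linear_map_on_scale: "x \<in> V \<Longrightarrow> T (a *\<^sub>R x) = a *\<^sub>R T x"
    and linear_map_on_diff: "x \<in> V \<Longrightarrow> y \<in> V \<Longrightarrow> T (x - y) = T x - T y"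
    and linear_map_on_minus: "x \<in> V \<Longrightarrow> T (- x) = - T x"
    and linear_map_on_0: "T 0 = 0"
proof -
  have *: "T (a *\<^sub>R x + b *\<^sub>R y) = a *\<^sub>R T x + b *\<^sub>R T y" if "x \<in> V" "y \<in> V" for a b x y
    using assms(1) that by (simp add: linear_map_on_def)
  show "x \<in> V \<Longrightarrow> y \<in> V \<Longrightarrow> T (x + y) = T x + T y"
    using *[of x y 1 1] by simp
  show "x \<in> V \<Longrightarrow> T (a *\<^sub>R x) = a *\<^sub>R T x"
    using *[of x x a 0] by simp
  show "x \<in> V \<Longrightarrow> y \<in> V \<Longrightarrow> T (x - y) = T x - T y"
    using *[of x y 1 "-1"] by simp
  show "x \<in> V \<Longrightarrow> T (- x) = - T x"
    using *[of x x "-1" 0] by simp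
  show "T 0 = 0"
    using *[of 0 0 0 0] subspace_0[OF assms(2)] by simp
qed

lemma linear_map_on_sum:
  assumes "linear_map_on V T" "subspace V" "\<And>i. i \<in> I \<Longrightarrow> v i \<in> V"
  shows "T (\<Sum>i\<in>I. a i *\<^sub>R v i) = (\<Sum>i\<in>I. a i *\<^sub>R T (v i))"
  using assms(3)
proof (induction I rule: infinite_finite_induct)
  case (insert i I)
  have "T (a i *\<^sub>R v i + (\<Sum>i\<in>I. a i *\<^sub>R v i)) = T (a i *\<^sub>R v i) + T (\<Sum>i\<in>I. a i *\<^sub>R v i)"
    using insert.prems
    by (intro linear_map_on_add[OF assms(1,2)] subspace_scale[OF assms(2)] subspace_sum[OF assms(2)]) auto
  then show ?case
    using insert linear_map_on_scale[OF assms(1,2)] by simp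
qed (simp_all add: linear_map_on_0[OF assms(1,2)])

text \<open>Independence of the trace of the basis, in the form needed for a trace that is defined by an
  unspecified basis.\<close>

lemma trace_on_eq:
  fixes V :: "'v::real_vector set"
  assumes E: "finite E" "independent E" "span E = V"
    and T: "linear_map_on V T" "\<And>v. v \<in> V \<Longrightarrow> T v \<in> V"
  shows "trace_on V T = (\<Sum>e\<in>E. representation E (T e) e)"
proof -
  define B where "B = (SOME B. independent B \<and> span B = V)"
  have "independent B \<and> span B = V"
    unfolding B_def by (rule someI[of _ E]) (use E in auto)
  then have B: "independent B" "span B = V" by auto
  have V: "subspace V" using B by auto
  have "finite B"
    using independent_span_bound[OF E(1) B(1)] span_superset[of B] B E by auto
  have BV: "b \<in> V" if "b \<in> B" for b using that B span_base by blast
  have EV: "e \<in> V" if "e \<in> E" for e using that E span_base by blast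
  have repB: "representation B (T b) b = (\<Sum>e\<in>E. representation E (T b) e * representation B e b)"
    if b: "b \<in> B" for b
  proof -
    have "T b = (\<Sum>e\<in>E. representation E (T b) e *\<^sub>R e)"
      by (rule sum_representation_eq[symmetric]) (use E T BV[OF b] in auto)
    then have "representation B (T b) = representation B (\<Sum>e\<in>E. representation E (T b) e *\<^sub>R e)"
      by simp
    also have "\<dots> = (\<lambda>b'. \<Sum>e\<in>E. representation B (representation E (T b) e *\<^sub>R e) b')"
      by (rule representation_sum[OF B(1)]) (use EV V B subspace_scale in auto)
    also have "\<dots> = (\<lambda>b'. \<Sum>e\<in>E. representation E (T b) e * representation B e b')"
      by (intro ext sum.cong refl) (use EV B in \<open>simp add: representation_scale[OF B(1)]\<close>)
    finally show ?thesis by simp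
  qed
  have repE: "representation E (T e) e = (\<Sum>b\<in>B. representation B e b * representation E (T b) e)"
    if e: "e \<in> E" for e
  proof -
    have "e = (\<Sum>b\<in>B. representation B e b *\<^sub>R b)"
      by (rule sum_representation_eq[symmetric]) (use B \<open>finite B\<close> EV[OF e] in auto)
    then have "T e = T (\<Sum>b\<in>B. representation B e b *\<^sub>R b)" by simp
    also have "\<dots> = (\<Sum>b\<in>B. representation B e b *\<^sub>R T b)"
      by (rule linear_map_on_sum[OF T(1) V BV])
    finally have "representation E (T e) = representation E (\<Sum>b\<in>B. representation B e b *\<^sub>R T b)"
      by simp
    also have "\<dots> = (\<lambda>e'. \<Sum>b\<in>B. representation E (representation B e b *\<^sub>R T b) e')"
      by (rule representation_sum[OF E(2)]) (use E(3) subspace_scale[OF V T(2)[OF BV]] in auto)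
    also have "\<dots> = (\<lambda>e'. \<Sum>b\<in>B. representation B e b * representation E (T b) e')"
      by (intro ext sum.cong refl) (use BV E T in \<open>simp add: representation_scale[OF E(2)]\<close>)
    finally show ?thesis by simp
  qed
  have "trace_on V T = (\<Sum>b\<in>B. representation B (T b) b)"
    by (simp add: trace_on_def B_def[symmetric])
  also have "\<dots> = (\<Sum>b\<in>B. \<Sum>e\<in>E. representation E (T b) e * representation B e b)"
    by (intro sum.cong refl repB)
  also have "\<dots> = (\<Sum>e\<in>E. \<Sum>b\<in>B. representation B e b * representation E (T b) e)"
    by (subst sum.swap) (simp add: mult.commute)
  also have "\<dots> = (\<Sum>e\<in>E. representation E (T e) e)"
    by (intro sum.cong refl repE[symmetric])
  finally show ?thesis .
qed


text \<open>The form may be indefinite, so that orthogonal systems have to avoid null vectors.\<close>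

locale nondegenerate_form =
  fixes V :: "'v::real_vector set" and G :: "'v \<Rightarrow> 'v \<Rightarrow> real"
  assumes V: "subspace V" and finite_dim: "\<exists>B. finite B \<and> span B = V"
    and G_linear: "v \<in> V \<Longrightarrow> linear_map_on V (G v)"
    and G_sym: "v \<in> V \<Longrightarrow> w \<in> V \<Longrightarrow> G v w = G w v"
    and G_nondegenerate: "v \<in> V \<Longrightarrow> (\<And>w. w \<in> V \<Longrightarrow> G v w = 0) \<Longrightarrow> v = 0"
begin

lemmas V_closed = subspace_add[OF V] subspace_diff[OF V] subspace_scale[OF V] subspace_neg[OF V] subspace_0[OF V]

lemma G_right:
  assumes "v \<in> V"
  shows "x \<in> V \<Longrightarrow> y \<in> V \<Longrightarrow> G v (x + y) = G v x + G v y"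
    and "x \<in> V \<Longrightarrow> y \<in> V \<Longrightarrow> G v (x - y) = G v x - G v y"
    and "x \<in> V \<Longrightarrow> G v (a *\<^sub>R x) = a * G v x"
    and "x \<in> V \<Longrightarrow> G v (- x) = - G v x"
    and "G v 0 = 0"
  using linear_map_onD[OF G_linear[OF assms] V] by simp_all

lemma G_left:
  assumes "v \<in> V"
  shows "x \<in> V \<Longrightarrow> y \<in> V \<Longrightarrow> G (x + y) v = G x v + G y v"
    and "x \<in> V \<Longrightarrow> y \<in> V \<Longrightarrow> G (x - y) v = G x v - G y v"
    and "x \<in> V \<Longrightarrow> G (a *\<^sub>R x) v = a * G x v"
    and "x \<in> V \<Longrightarrow> G (- x) v = - G x v"
    and "G 0 v = 0"
  using G_right[OF assms] G_sym[OF assms] V_closed by metis+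

lemma G_sum_left:
  assumes "\<And>i. i \<in> I \<Longrightarrow> v i \<in> V" "w \<in> V"
  shows "G (\<Sum>i\<in>I. a i *\<^sub>R v i) w = (\<Sum>i\<in>I. a i * G (v i) w)"
proof -
  have "(\<Sum>i\<in>I. a i *\<^sub>R v i) \<in> V" by (intro subspace_sum[OF V] subspace_scale[OF V] assms)
  then have "G (\<Sum>i\<in>I. a i *\<^sub>R v i) w = G w (\<Sum>i\<in>I. a i *\<^sub>R v i)" using G_sym assms by blast
  also have "\<dots> = (\<Sum>i\<in>I. a i * G w (v i))"
    using linear_map_on_sum[OF G_linear[OF assms(2)] V assms(1)] by simp
  also have "\<dots> = (\<Sum>i\<in>I. a i * G (v i) w)"
    using G_sym assms by (intro sum.cong) auto
  finally show ?thesis .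
qed

definition orthogonal_system :: "'v set \<Rightarrow> bool"
  where "orthogonal_system E \<longleftrightarrow> finite E \<and> E \<subseteq> V \<and> (\<forall>e\<in>E. G e e \<noteq> 0) \<and>
    (\<forall>e\<in>E. \<forall>f\<in>E. e \<noteq> f \<longrightarrow> G e f = 0)"

lemma orthogonal_coefficient:
  assumes E: "orthogonal_system E" and e: "e \<in> E"
  shows "G (\<Sum>f\<in>E. a f *\<^sub>R f) e = a e * G e e"
proof -
  have "G (\<Sum>f\<in>E. a f *\<^sub>R f) e = (\<Sum>f\<in>E. a f * G f e)"
    using E e by (intro G_sum_left) (auto simp: orthogonal_system_def)
  also have "\<dots> = (\<Sum>f\<in>E. if f = e then a e * G e e else 0)"
    using E e by (intro sum.cong) (auto simp: orthogonal_system_def)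
  finally show ?thesis using E e by (simp add: orthogonal_system_def)
qed

lemma orthogonal_system_independent:
  assumes E: "orthogonal_system E"
  shows "independent E"
proof (rule independent_if_scalars_zero)
  show "finite E" using E by (simp add: orthogonal_system_def)
  fix a e assume "(\<Sum>f\<in>E. a f *\<^sub>R f) = 0" "e \<in> E"
  then have "a e * G e e = 0"
    using orthogonal_coefficient[OF E, of e a] G_left(5)[of e] E by (auto simp: orthogonal_system_def)
  then show "a e = 0" using E \<open>e \<in> E\<close> by (auto simp: orthogonal_system_def)
qed

text \<open>If the orthogonal complement of \<open>E\<close> contained only null vectors, the form would vanish on it by
  polarization. Its elements would then be orthogonal to all of \<open>V\<close>, because the vectors of \<open>V\<close> differ
  from elements of the complement by combinations of \<open>E\<close>, so the complement would be zero and \<open>E\<close> would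
  span \<open>V\<close>.\<close>

lemma orthogonal_system_extend:
  assumes E: "orthogonal_system E" and card: "card E < dim V"
  obtains u where "u \<in> V" "\<And>e. e \<in> E \<Longrightarrow> G u e = 0" "G u u \<noteq> 0" "u \<notin> E" "orthogonal_system (insert u E)"
proof -
  let ?W = "{u \<in> V. \<forall>e\<in>E. G u e = 0}"
  have EV: "E \<subseteq> V" and finE: "finite E" using E by (auto simp: orthogonal_system_def)
  \<comment> \<open>The orthogonal projection onto the span of \<open>E\<close>.\<close>
  define pr where "pr v = (\<Sum>e\<in>E. (G v e / G e e) *\<^sub>R e)" for v
  have prV: "pr v \<in> V" for v
    unfolding pr_def using EV by (intro subspace_sum[OF V] subspace_scale[OF V]) auto
  have res: "v - pr v \<in> ?W" if v: "v \<in> V" for v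
  proof -
    have "G (v - pr v) e = 0" if e: "e \<in> E" for e
    proof -
      have "G (pr v) e = G v e"
        using orthogonal_coefficient[OF E e, of "\<lambda>e. G v e / G e e"] E e
        by (simp add: pr_def orthogonal_system_def)
      then show ?thesis using G_left(2)[of e v "pr v"] prV v e EV by auto
    qed
    then show ?thesis using V_closed(2)[OF v prV] by simp
  qed
  have "\<exists>u\<in>?W. G u u \<noteq> 0"
  proof (rule ccontr)
    assume "\<not> ?thesis"
    then have null: "G u u = 0" if "u \<in> ?W" for u using that by blast
    have WW: "G u w = 0" if "u \<in> ?W" "w \<in> ?W" for u w
    proof -
      have uw: "u \<in> V" "w \<in> V" using that by auto
      have "u + w \<in> ?W"
        using that EV by (auto simp: V_closed G_left)
      then have "G (u + w) (u + w) = 0" by (rule null)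
      then show ?thesis
        using null[OF that(1)] null[OF that(2)] G_sym[OF uw] uw by (simp add: G_left G_right V_closed)
    qed
    have "u = 0" if u: "u \<in> ?W" for u
    proof (rule G_nondegenerate)
      show uV: "u \<in> V" using u by simp
      fix v assume v: "v \<in> V"
      have "G (pr v) u = (\<Sum>e\<in>E. (G v e / G e e) * G e u)"
        unfolding pr_def by (rule G_sum_left) (use EV uV in auto)
      also have "\<dots> = 0"
        using u G_sym[OF uV] subsetD[OF EV] by (intro sum.neutral) simp
      finally have "G u (pr v) = 0" using G_sym[OF uV prV] by simp
      moreover have "G u (v - pr v) = 0" using WW u res[OF v] by blast
      ultimately show "G u v = 0" using G_right(2)[OF uV v prV, of v] by simp
    qed
    then have pr: "v - pr v = 0" if "v \<in> V" for v using res[OF that] .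
    have "v \<in> span E" if "v \<in> V" for v
    proof -
      have "pr v \<in> span E" unfolding pr_def by (intro span_sum span_scale span_base)
      then show ?thesis using pr[OF that] by simp
    qed
    then have "V \<subseteq> span E" by (rule subsetI)
    then have "dim V \<le> card E" using dim_le_card finE by blast
    with card show False by simp
  qed
  then obtain u where u: "u \<in> V" "\<And>e. e \<in> E \<Longrightarrow> G u e = 0" "G u u \<noteq> 0" by blast
  from u(2)[of u] u(3) have nE: "u \<notin> E" by iprover
  have sys: "orthogonal_system (insert u E)"
  proof -
    have "G e u = 0" if "e \<in> E" for e
      using that u(2)[of e] G_sym[OF u(1), of e] EV by auto
    then show ?thesis using E u by (simp add: orthogonal_system_def)
  qed
  show thesis by (rule that[OF u(1) _ u(3) nE sys]) (rule u(2))
qed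

definition orthogonal_basis :: "'v set \<Rightarrow> bool"
  where "orthogonal_basis E \<longleftrightarrow> orthogonal_system E \<and> card E = dim V"

lemma orthogonal_basis_span:
  assumes E: "orthogonal_basis E"
  shows "span E = V"
proof
  have sys: "orthogonal_system E" and card: "card E = dim V"
    using E by (simp_all add: orthogonal_basis_def)
  then have EV: "E \<subseteq> V" and finE: "finite E"
    by (simp_all add: orthogonal_system_def)
  have ind: "independent E" by (rule orthogonal_system_independent[OF sys])
  show "span E \<subseteq> V" using EV V by (rule span_minimal)
  obtain B where B: "finite B" "span B = V" using finite_dim by blast
  obtain C where C: "C \<subseteq> B" "independent C" "B \<subseteq> span C"
    by (rule maximal_independent_subset[of B])
  have CV: "span C = V"
    using span_mono[OF C(1)] span_minimal[OF C(3) subspace_span] B(2) by simp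
  have "finite C" by (rule finite_subset[OF C(1) B(1)])
  have "span C = span V" using CV V by (simp add: span_eq_iff[THEN iffD2])
  then have dimC: "dim V = card C" using C(2) by (rule dim_eq_card)
  show "V \<subseteq> span E"
  proof
    fix v assume v: "v \<in> V"
    show "v \<in> span E"
    proof (rule ccontr)
      assume nv: "v \<notin> span E"
      then have "independent (insert v E)" using ind by (simp add: independent_insertI)
      then have "card (insert v E) \<le> card C"
        using independent_span_bound[OF \<open>finite C\<close>, of "insert v E"] CV v EV by simp
      moreover have "v \<notin> E" using nv span_base[of v E] by iprover
      ultimately show False using finE card dimC by simp
    qed
  qed
qed

lemma orthogonal_basisD:
  assumes "orthogonal_basis E"
  shows "orthogonal_system E" "finite E" "independent E" "span E = V"
    and "e \<in> E \<Longrightarrow> e \<in> V" "e \<in> E \<Longrightarrow> G e e \<noteq> 0"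
proof -
  show sys: "orthogonal_system E" using assms by (simp add: orthogonal_basis_def)
  then show "finite E" "e \<in> E \<Longrightarrow> e \<in> V" "e \<in> E \<Longrightarrow> G e e \<noteq> 0"
    by (auto simp: orthogonal_system_def)
  show "independent E" by (rule orthogonal_system_independent[OF sys])
  show "span E = V" by (rule orthogonal_basis_span[OF assms])
qed

lemma representation_orthogonal_basis:
  assumes E: "orthogonal_basis E" and v: "v \<in> V" and e: "e \<in> E"
  shows "representation E v e = G v e / G e e"
proof -
  note E' = orthogonal_basisD[OF E]
  have "v \<in> span E" using v E'(4) by simp
  have "(\<Sum>f\<in>E. representation E v f *\<^sub>R f) = v"
    by (rule sum_representation_eq[OF E'(3) \<open>v \<in> span E\<close> E'(2) subset_refl])
  then have "G v e = representation E v e * G e e"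
    using orthogonal_coefficient[OF E'(1) e, of "representation E v"] by (simp only:)
  then show ?thesis using E'(6)[OF e] by (simp only: nonzero_mult_div_cancel_right not_False_eq_True)
qed

lemma orthogonal_expansion:
  assumes E: "orthogonal_basis E" and v: "v \<in> V"
  shows "(\<Sum>e\<in>E. (G v e / G e e) *\<^sub>R e) = v"
proof -
  note E' = orthogonal_basisD[OF E]
  have "v \<in> span E" using v E'(4) by simp
  have "(\<Sum>e\<in>E. (G v e / G e e) *\<^sub>R e) = (\<Sum>e\<in>E. representation E v e *\<^sub>R e)"
    by (intro sum.cong refl) (simp only: representation_orthogonal_basis[OF E v])
  also have "\<dots> = v"
    by (rule sum_representation_eq[OF E'(3) \<open>v \<in> span E\<close> E'(2) subset_refl])
  finally show ?thesis .
qed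

lemma eq_0_if_orthogonal_to_basis:
  assumes "orthogonal_basis E" "v \<in> V" "\<And>e. e \<in> E \<Longrightarrow> G v e = 0"
  shows "v = 0"
proof -
  have "(\<Sum>e\<in>E. (G v e / G e e) *\<^sub>R e) = 0" using assms(3) by simp
  then show ?thesis using orthogonal_expansion[OF assms(1,2)] by simp
qed

lemma trace_on_orthogonal_basis:
  assumes E: "orthogonal_basis E" and T: "linear_map_on V T" "\<And>v. v \<in> V \<Longrightarrow> T v \<in> V"
  shows "trace_on V T = (\<Sum>e\<in>E. G (T e) e / G e e)"
proof -
  have sys: "orthogonal_system E" using E by (simp add: orthogonal_basis_def)
  then have EV: "finite E" "E \<subseteq> V" by (auto simp: orthogonal_system_def)
  have "trace_on V T = (\<Sum>e\<in>E. representation E (T e) e)"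
    by (rule trace_on_eq[OF EV(1) orthogonal_system_independent[OF sys] orthogonal_basis_span[OF E] T])
  also have "\<dots> = (\<Sum>e\<in>E. G (T e) e / G e e)"
    using EV T by (intro sum.cong refl representation_orthogonal_basis[OF E]) auto
  finally show ?thesis .
qed

text \<open>Applied to the Ricci tensor, whose associated endomorphism is the Ricci operator.\<close>

lemma trace_on_raised_form:
  assumes E: "orthogonal_basis E"
    and S1: "\<And>y. y \<in> V \<Longrightarrow> linear_map_on V (\<lambda>x. S x y)"
    and S2: "\<And>x. x \<in> V \<Longrightarrow> linear_map_on V (S x)"
  shows "trace_on V (\<lambda>x. THE w. w \<in> V \<and> (\<forall>y\<in>V. G w y = S x y)) = (\<Sum>e\<in>E. S e e / G e e)"
proof -
  let ?P = "\<lambda>x w. w \<in> V \<and> (\<forall>y\<in>V. G w y = S x y)"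
  let ?Q = "\<lambda>x. THE w. ?P x w"
  have sys: "orthogonal_system E" using E by (simp add: orthogonal_basis_def)
  then have EV: "finite E" "E \<subseteq> V" by (auto simp: orthogonal_system_def)
  have unique: "w = w'" if "?P x w" "?P x w'" for x w w'
  proof -
    have "G (w - w') y = 0" if y: "y \<in> V" for y
      using that \<open>?P x w\<close> \<open>?P x w'\<close> by (simp add: G_left)
    then have "w - w' = 0" using that by (intro G_nondegenerate) (auto simp: V_closed)
    then show ?thesis by simp
  qed
  have "\<exists>w. ?P x w" if x: "x \<in> V" for x
  proof -
    let ?w = "\<Sum>e\<in>E. (S x e / G e e) *\<^sub>R e"
    have wV: "?w \<in> V" using EV by (intro subspace_sum[OF V] subspace_scale[OF V]) auto
    have "G ?w y = S x y" if y: "y \<in> V" for y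
    proof -
      have "S x y = S x (\<Sum>e\<in>E. (G y e / G e e) *\<^sub>R e)"
        using orthogonal_expansion[OF E y] by simp
      also have "\<dots> = (\<Sum>e\<in>E. (G y e / G e e) *\<^sub>R S x e)"
        by (rule linear_map_on_sum[OF S2[OF x] V]) (use EV in auto)
      also have "\<dots> = (\<Sum>e\<in>E. (S x e / G e e) * G e y)"
        using EV y G_sym by (intro sum.cong) auto
      also have "\<dots> = G ?w y" using EV y by (intro G_sum_left[symmetric]) auto
      finally show ?thesis by simp
    qed
    then show ?thesis using wV by blast
  qed
  then have Q: "?P x (?Q x)" if "x \<in> V" for x
    using that theI'[of "?P x"] unique by blast
  have "linear_map_on V ?Q"
    unfolding linear_map_on_def
  proof (intro ballI allI)
    fix x y a b assume xy: "x \<in> V" "y \<in> V"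
    have "S (a *\<^sub>R x + b *\<^sub>R y) z = a * S x z + b * S y z" if "z \<in> V" for z
      using S1[OF that] xy by (simp add: linear_map_on_def)
    then have "?P (a *\<^sub>R x + b *\<^sub>R y) (a *\<^sub>R ?Q x + b *\<^sub>R ?Q y)"
      using Q[OF xy(1)] Q[OF xy(2)] by (simp add: V_closed G_left)
    moreover have "?P (a *\<^sub>R x + b *\<^sub>R y) (?Q (a *\<^sub>R x + b *\<^sub>R y))"
      using Q xy by (simp add: V_closed)
    ultimately show "?Q (a *\<^sub>R x + b *\<^sub>R y) = a *\<^sub>R ?Q x + b *\<^sub>R ?Q y"
      using unique by blast
  qed
  then have "trace_on V ?Q = (\<Sum>e\<in>E. G (?Q e) e / G e e)"
    by (rule trace_on_orthogonal_basis[OF E]) (use Q in blast)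
  also have "\<dots> = (\<Sum>e\<in>E. S e e / G e e)"
    using Q EV by (intro sum.cong) auto
  finally show ?thesis .
qed

end

section \<open>Algebraic curvature tensors\<close>

locale curvature_like = nondegenerate_form V G
  for V :: "'v::real_vector set" and G +
  fixes T :: "'v \<Rightarrow> 'v \<Rightarrow> 'v \<Rightarrow> 'v"
  assumes T_closed: "x \<in> V \<Longrightarrow> y \<in> V \<Longrightarrow> z \<in> V \<Longrightarrow> T x y z \<in> V"
    and T_linear1: "y \<in> V \<Longrightarrow> z \<in> V \<Longrightarrow> linear_map_on V (\<lambda>x. T x y z)"
    and T_linear3: "x \<in> V \<Longrightarrow> y \<in> V \<Longrightarrow> linear_map_on V (T x y)"
    and T_antisym: "x \<in> V \<Longrightarrow> y \<in> V \<Longrightarrow> z \<in> V \<Longrightarrow> T x y z = - T y x z"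
    and T_skew: "x \<in> V \<Longrightarrow> y \<in> V \<Longrightarrow> z \<in> V \<Longrightarrow> w \<in> V \<Longrightarrow> G (T x y z) w = - G (T x y w) z"
    and T_Bianchi: "x \<in> V \<Longrightarrow> y \<in> V \<Longrightarrow> z \<in> V \<Longrightarrow> T x y z + T y z x + T z x y = 0"
begin

lemma T_linear2:
  assumes "x \<in> V" "z \<in> V"
  shows "linear_map_on V (\<lambda>y. T x y z)"
  unfolding linear_map_on_def
proof (intro ballI allI)
  fix y y' a b assume y: "y \<in> V" "y' \<in> V"
  have "T x (a *\<^sub>R y + b *\<^sub>R y') z = - T (a *\<^sub>R y + b *\<^sub>R y') x z"
    using assms y by (intro T_antisym) (auto simp: V_closed)
  also have "\<dots> = - (a *\<^sub>R T y x z + b *\<^sub>R T y' x z)"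
    using T_linear1[OF assms] y by (simp add: linear_map_on_def)
  also have "\<dots> = a *\<^sub>R T x y z + b *\<^sub>R T x y' z"
    using T_antisym[OF assms(1) y(1) assms(2)] T_antisym[OF assms(1) y(2) assms(2)] by simp
  finally show "T x (a *\<^sub>R y + b *\<^sub>R y') z = a *\<^sub>R T x y z + b *\<^sub>R T x y' z" .
qed

lemma T_same: "x \<in> V \<Longrightarrow> z \<in> V \<Longrightarrow> T x x z = 0"
  using T_antisym[of x x z] by (simp add: eq_neg_iff_add_eq_0 scaleR_2[symmetric])

lemma T_skew_same: "x \<in> V \<Longrightarrow> y \<in> V \<Longrightarrow> z \<in> V \<Longrightarrow> G (T x y z) z = 0"
  using T_skew[of x y z z] by simp

text \<open>By skew-symmetry in the last two arguments and the hypothesis on \<open>u\<close>, everything is determined by the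
  alternating form \<open>(x,y) \<mapsto> G (T x y a) b\<close>. It vanishes on \<open>(a,b)\<close> by hypothesis. The Bianchi identity
  gives \<open>T u a b = T u b a\<close>, so on \<open>(u,a)\<close> and \<open>(u,b)\<close> the form equals, up to sign, \<open>G (T u b a) a\<close> and
  \<open>G (T u a b) b\<close>, which are zero by skew-symmetry.\<close>

lemma curvature_zero_if_nullity_and_sectional_zero:
  assumes E: "orthogonal_basis {u, a, b}" and distinct: "u \<noteq> a" "u \<noteq> b" "a \<noteq> b"
    and null: "\<And>x y. x \<in> V \<Longrightarrow> y \<in> V \<Longrightarrow> T x y u = 0"
    and sectional: "G (T a b b) a = 0"
    and xyz: "x \<in> V" "y \<in> V" "z \<in> V"
  shows "T x y z = 0"
proof -
  have uab: "u \<in> V" "a \<in> V" "b \<in> V"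
    using E by (auto simp: orthogonal_basis_def orthogonal_system_def)
  have expand: "\<exists>r s t. v = r *\<^sub>R u + (s *\<^sub>R a + t *\<^sub>R b)" if "v \<in> V" for v
  proof (intro exI)
    show "v = (G v u / G u u) *\<^sub>R u + ((G v a / G a a) *\<^sub>R a + (G v b / G b b) *\<^sub>R b)"
      using orthogonal_expansion[OF E that] distinct by simp
  qed
  have swap: "T u a b = T u b a"
    using T_Bianchi[OF uab] null[OF uab(2,3)] T_antisym[OF uab(3,1,2)] by simp
  have ua: "G (T u a a) b = 0"
    using T_skew[of u a a b] uab swap T_skew_same[of u b a] by simp
  have ub: "G (T u b a) b = 0"
    using swap T_skew_same[of u a b] uab by simp
  have ab: "G (T a b a) b = 0"
    using T_skew[of a b a b] uab sectional by simp
  have key: "G (T v w a) b = 0" if v: "v \<in> V" and w: "w \<in> V" for v w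
  proof -
    obtain r s t where v': "v = r *\<^sub>R u + (s *\<^sub>R a + t *\<^sub>R b)" using expand[OF v] by blast
    obtain r' s' t' where w': "w = r' *\<^sub>R u + (s' *\<^sub>R a + t' *\<^sub>R b)" using expand[OF w] by blast
    have l: "G (T (r *\<^sub>R u + (s *\<^sub>R a + t *\<^sub>R b)) y a) b
        = r * G (T u y a) b + (s * G (T a y a) b + t * G (T b y a) b)" if y: "y \<in> V" for y r s t
      using y uab by (simp add: linear_map_on_add[OF T_linear1 V] linear_map_on_scale[OF T_linear1 V]
          V_closed T_closed G_left)
    have anti: "G (T x y a) b = - G (T y x a) b" if "x \<in> V" "y \<in> V" for x y
      using T_antisym[OF that uab(2)] that uab by (simp add: G_left T_closed)
    have "G (T v e a) b = 0" if "e \<in> {u, a, b}" for e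
      using that l[of e r s t] ua ub ab anti[of a u] anti[of b u] anti[of b a] uab
        T_same[of e a] G_left(5)[of b] unfolding v'[symmetric] by auto
    then have "G (T e v a) b = 0" if "e \<in> {u, a, b}" for e
      using that anti[of e v] uab v by auto
    then have "G (T w v a) b = 0" using l[OF v, of r' s' t'] unfolding w'[symmetric] by simp
    then show ?thesis using anti[OF v w] by simp
  qed
  have "T x y a = 0"
    using uab xyz key[OF xyz(1,2)] T_skew[of x y a u] null[OF xyz(1,2)] T_skew_same[of x y a]
    by (intro eq_0_if_orthogonal_to_basis[OF E]) (auto simp: T_closed G_left)
  moreover have "T x y b = 0"
    using uab xyz key[OF xyz(1,2)] T_skew[of x y b u] T_skew[of x y b a] null[OF xyz(1,2)] T_skew_same[of x y b]
    by (intro eq_0_if_orthogonal_to_basis[OF E]) (auto simp: T_closed G_left)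
  ultimately show ?thesis
    using expand[OF xyz(3)] uab xyz null[OF xyz(1,2)]
    by (auto simp: linear_map_on_add[OF T_linear3 V] linear_map_on_scale[OF T_linear3 V] V_closed)
qed

end

section \<open>Curvature of the Levi-Civita connection\<close>

lemma scale_field_at: "scale_field f X p = f p *\<^sub>R X p"
  by (simp add: scale_field_def)

locale semi_riemannian_manifold = smooth_manifold A
  for A :: "('m::{t2_space, second_countable_topology}, 'e::euclidean_space) chart set" +
  fixes g :: "'m \<Rightarrow> 'm tvec \<Rightarrow> 'm tvec \<Rightarrow> real" and D :: "'m connection"
  assumes is_metric: "semi_riemannian_metric A g"
    and is_levi_civita: "levi_civita_connection A g D"
begin

lemma form_at: "nondegenerate_form (tangent_space A p) (g p)"
proof (rule nondegenerate_form.intro)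
  show "subspace (tangent_space A p)" by (rule subspace_tangent_space)
  show "\<exists>B. finite B \<and> span B = tangent_space A p"
  proof -
    obtain B where "finite B" "span B = tangent_space A p" by (rule finite_dim_tangent_space)
    then show ?thesis by (intro exI[of _ B] conjI)
  qed
  show "linear_map_on (tangent_space A p) (g p v)" if "v \<in> tangent_space A p" for v
    using is_metric that by (simp add: semi_riemannian_metric_def)
  show "g p v w = g p w v" if "v \<in> tangent_space A p" "w \<in> tangent_space A p" for v w
    using is_metric that by (simp add: semi_riemannian_metric_def)
  show "v = 0" if "v \<in> tangent_space A p" "\<And>w. w \<in> tangent_space A p \<Longrightarrow> g p v w = 0" for v
    by (rule is_metric[unfolded semi_riemannian_metric_def, THEN conjunct2, THEN conjunct2,
          THEN conjunct1, rule_format, OF that])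
qed

lemma smooth_metric:
  "X \<in> vector_fields A \<Longrightarrow> Y \<in> vector_fields A \<Longrightarrow> (\<lambda>p. g p (X p) (Y p)) \<in> smooth_functions A"
  using is_metric by (simp add: semi_riemannian_metric_def)

lemmas levi_civita_properties =
  is_levi_civita[unfolded levi_civita_connection_def affine_connection_def]

lemma D_closed: "X \<in> vector_fields A \<Longrightarrow> Y \<in> vector_fields A \<Longrightarrow> D X Y \<in> vector_fields A"
  by (rule levi_civita_properties[THEN conjunct1, THEN conjunct1, rule_format])

lemma D_add_right:
  "X \<in> vector_fields A \<Longrightarrow> Y \<in> vector_fields A \<Longrightarrow> Z \<in> vector_fields A \<Longrightarrow> D X (Y + Z) = D X Y + D X Z"
  by (rule levi_civita_properties[THEN conjunct1, THEN conjunct2, THEN conjunct2, THEN conjunct1, rule_format])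

lemma D_scale_right:
  "X \<in> vector_fields A \<Longrightarrow> Y \<in> vector_fields A \<Longrightarrow> f \<in> smooth_functions A \<Longrightarrow>
    D X (scale_field f Y) = scale_field (\<lambda>p. X p f) Y + scale_field f (D X Y)"
  by (rule levi_civita_properties[THEN conjunct1, THEN conjunct2, THEN conjunct2, THEN conjunct2, rule_format])

lemma D_combination_left:
  "X \<in> vector_fields A \<Longrightarrow> Y \<in> vector_fields A \<Longrightarrow> Z \<in> vector_fields A \<Longrightarrow>
    f \<in> smooth_functions A \<Longrightarrow> h \<in> smooth_functions A \<Longrightarrow>
    D (scale_field f X + scale_field h Y) Z = scale_field f (D X Z) + scale_field h (D Y Z)"
  by (rule levi_civita_properties[THEN conjunct1, THEN conjunct2, THEN conjunct1, rule_format])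

lemma lie_bracket_eq:
  "X \<in> vector_fields A \<Longrightarrow> Y \<in> vector_fields A \<Longrightarrow> lie_bracket X Y = D X Y - D Y X"
  by (rule levi_civita_properties[THEN conjunct2, THEN conjunct1, rule_format, symmetric])

lemma metric_compatible:
  "X \<in> vector_fields A \<Longrightarrow> Y \<in> vector_fields A \<Longrightarrow> Z \<in> vector_fields A \<Longrightarrow>
    X p (\<lambda>q. g q (Y q) (Z q)) = g p (D X Y p) (Z p) + g p (Y p) (D X Z p)"
  by (rule levi_civita_properties[THEN conjunct2, THEN conjunct2, rule_format])

lemma scale_field_const: "scale_field (\<lambda>q. 1) X = X" "scale_field (\<lambda>q. 0) X = 0"
  by (rule ext, simp only: scale_field_at scaleR_one,
      rule ext, simp only: scale_field_at scaleR_zero_left zero_fun_apply)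

lemma D_add_left:
  "X \<in> vector_fields A \<Longrightarrow> Y \<in> vector_fields A \<Longrightarrow> Z \<in> vector_fields A \<Longrightarrow> D (X + Y) Z = D X Z + D Y Z"
  using D_combination_left[of X Y Z "\<lambda>q. 1" "\<lambda>q. 1"] by (simp only: scale_field_const smooth_const)

lemma D_scale_left:
  "X \<in> vector_fields A \<Longrightarrow> Z \<in> vector_fields A \<Longrightarrow> f \<in> smooth_functions A \<Longrightarrow>
    D (scale_field f X) Z = scale_field f (D X Z)"
  using D_combination_left[of X X Z f "\<lambda>q. 0"] by (simp only: scale_field_const smooth_const add_0_right)

lemma D_minus_left: "X \<in> vector_fields A \<Longrightarrow> Z \<in> vector_fields A \<Longrightarrow> D (- X) Z = - D X Z"
  using D_scale_left[of X Z "\<lambda>q. -1"] by (simp only: scale_field_minus_one smooth_const)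

lemma D_diff_left:
  assumes "X \<in> vector_fields A" "Y \<in> vector_fields A" "Z \<in> vector_fields A"
  shows "D (X - Y) Z = D X Z - D Y Z"
  using D_add_left[OF assms(1) vector_field_minus[OF assms(2)] assms(3)] D_minus_left[OF assms(2,3)]
  by (simp only: add_uminus_conv_diff)

lemma D_diff_right:
  assumes "X \<in> vector_fields A" "Y \<in> vector_fields A" "Z \<in> vector_fields A"
  shows "D X (Y - Z) = D X Y - D X Z"
  using D_add_right[OF assms(1) vector_field_diff[OF assms(2,3)] assms(3)]
  by (simp only: diff_add_cancel eq_diff_eq)

lemma lie_bracket_closed:
  "X \<in> vector_fields A \<Longrightarrow> Y \<in> vector_fields A \<Longrightarrow> lie_bracket X Y \<in> vector_fields A"
  by (simp only: lie_bracket_eq vector_field_diff D_closed)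

lemma curvature_closed:
  "X \<in> vector_fields A \<Longrightarrow> Y \<in> vector_fields A \<Longrightarrow> Z \<in> vector_fields A \<Longrightarrow>
    curvature D X Y Z \<in> vector_fields A"
  unfolding curvature_def by (intro vector_field_diff D_closed lie_bracket_closed)

lemma curvature_antisym:
  assumes X: "X \<in> vector_fields A" and Y: "Y \<in> vector_fields A" and Z: "Z \<in> vector_fields A"
  shows "curvature D X Y Z = - curvature D Y X Z"
proof -
  have "lie_bracket X Y = - lie_bracket Y X"
    by (simp only: lie_bracket_eq X Y minus_diff_eq)
  then have "D (lie_bracket X Y) Z = - D (lie_bracket Y X) Z"
    by (simp only: D_minus_left lie_bracket_closed X Y Z)
  then show ?thesis
    unfolding curvature_def by (simp only:) (rule ext, simp)
qed

lemma curvature_add_1: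
  assumes X: "X \<in> vector_fields A" and W: "W \<in> vector_fields A"
    and Y: "Y \<in> vector_fields A" and Z: "Z \<in> vector_fields A"
  shows "curvature D (X + W) Y Z = curvature D X Y Z + curvature D W Y Z"
proof -
  have "lie_bracket (X + W) Y = lie_bracket X Y + lie_bracket W Y"
    by (simp only: lie_bracket_eq vector_field_add X W Y D_add_left D_add_right add_diff_add)
  then have "D (lie_bracket (X + W) Y) Z = D (lie_bracket X Y) Z + D (lie_bracket W Y) Z"
    by (simp only: D_add_left lie_bracket_closed X W Y Z)
  then show ?thesis
    unfolding curvature_def
    by (simp only: D_add_left D_add_right X W Y Z D_closed) (simp only: add_diff_add)
qed

lemma curvature_add_3:
  assumes X: "X \<in> vector_fields A" and Y: "Y \<in> vector_fields A"
    and Z: "Z \<in> vector_fields A" and W: "W \<in> vector_fields A"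
  shows "curvature D X Y (Z + W) = curvature D X Y Z + curvature D X Y W"
  unfolding curvature_def
  by (simp only: D_add_right X W Y Z D_closed lie_bracket_closed) (simp only: add_diff_add)

lemma curvature_scale_1:
  assumes X: "X \<in> vector_fields A" and Y: "Y \<in> vector_fields A" and Z: "Z \<in> vector_fields A"
    and f: "f \<in> smooth_functions A"
  shows "curvature D (scale_field f X) Y Z = scale_field f (curvature D X Y Z)"
proof -
  have Yf: "(\<lambda>q. Y q f) \<in> smooth_functions A" by (rule vector_fieldD(2)[OF Y f])
  have "lie_bracket (scale_field f X) Y = scale_field f (lie_bracket X Y) - scale_field (\<lambda>q. Y q f) X"
    by (simp only: lie_bracket_eq vector_field_scale X Y f D_scale_left D_scale_right)
      (rule ext, simp add: scale_field_at scaleR_diff_right)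
  then have "D (lie_bracket (scale_field f X) Y) Z
      = scale_field f (D (lie_bracket X Y) Z) - scale_field (\<lambda>q. Y q f) (D X Z)"
    by (simp only: D_diff_left D_scale_left vector_field_scale lie_bracket_closed X Y Z f Yf)
  then show ?thesis
    unfolding curvature_def
    by (simp only: D_scale_left D_scale_right vector_field_scale D_closed X Y Z f)
      (rule ext, simp add: scale_field_at scaleR_diff_right)
qed

lemma curvature_scale_3:
  assumes X: "X \<in> vector_fields A" and Y: "Y \<in> vector_fields A" and Z: "Z \<in> vector_fields A"
    and f: "f \<in> smooth_functions A"
  shows "curvature D X Y (scale_field f Z) = scale_field f (curvature D X Y Z)"
proof -
  have Xf: "(\<lambda>q. X q f) \<in> smooth_functions A" and Yf: "(\<lambda>q. Y q f) \<in> smooth_functions A"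
    by (rule vector_fieldD(2)[OF X f], rule vector_fieldD(2)[OF Y f])
  show ?thesis
    unfolding curvature_def
    by (simp only: D_scale_right D_add_right vector_field_scale D_closed lie_bracket_closed X Y Z f Xf Yf)
      (rule ext, simp add: scale_field_at scaleR_diff_right lie_bracket_def scaleR_diff_left)
qed

text \<open>Tensoriality in the second argument follows from that in the first by antisymmetry.\<close>

lemma curvature_pointwise:
  assumes X: "X \<in> vector_fields A" "X' \<in> vector_fields A" "X p = X' p"
    and Y: "Y \<in> vector_fields A" "Y' \<in> vector_fields A" "Y p = Y' p"
    and Z: "Z \<in> vector_fields A" "Z' \<in> vector_fields A" "Z p = Z' p"
  shows "curvature D X Y Z p = curvature D X' Y' Z' p"
proof -
  \<comment> \<open>Also applied to the second argument, after exchanging it with the first.\<close>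
  have first: "curvature D U V W p = curvature D U' V W p"
    if "U \<in> vector_fields A" "U' \<in> vector_fields A" "U p = U' p" "V \<in> vector_fields A" "W \<in> vector_fields A"
    for U U' V W
    by (rule tensorial_pointwise[of "\<lambda>U. curvature D U V W"])
      (simp_all only: that curvature_add_1 curvature_scale_1)
  have "curvature D X Y Z p = curvature D X' Y Z p"
    by (rule first) (fact X Y Z)+
  also have "\<dots> = - curvature D Y X' Z p"
    by (simp only: curvature_antisym[OF X(2) Y(1) Z(1)] fun_Compl_def)
  also have "\<dots> = - curvature D Y' X' Z p"
    by (simp only: first[OF Y X(2) Z(1)])
  also have "\<dots> = curvature D X' Y' Z p"
    by (simp only: curvature_antisym[OF X(2) Y(2) Z(1)] fun_Compl_def)
  also have "\<dots> = curvature D X' Y' Z' p"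
    by (rule tensorial_pointwise[of "curvature D X' Y'"])
      (simp_all only: X Y Z curvature_add_3 curvature_scale_3)
  finally show ?thesis .
qed

lemma curvature_eq_at:
  assumes "X \<in> vector_fields A" "Y \<in> vector_fields A" "Z \<in> vector_fields A"
  shows "curvature D X Y Z p = curvature_at A D p (X p) (Y p) (Z p)"
  unfolding curvature_at_def
  by (rule curvature_pointwise) (simp_all only: assms extend_vec vector_fieldD)

text \<open>For \<open>h = g(Z,Z)\<close> compatibility with the metric gives \<open>X(Y h) - Y(X h) - [X,Y] h = 2 g(R(X,Y)Z,Z)\<close>,
  and the left-hand side is zero.\<close>

lemma curvature_skew_same:
  assumes X: "X \<in> vector_fields A" and Y: "Y \<in> vector_fields A" and Z: "Z \<in> vector_fields A"
  shows "g p (curvature D X Y Z p) (Z p) = 0"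
proof -
  interpret nondegenerate_form "tangent_space A p" "g p" by (rule form_at)
  let ?h = "\<lambda>q. g q (Z q) (Z q)"
  have d1: "W q ?h = 2 * g q (D W Z q) (Z q)" if W: "W \<in> vector_fields A" for W q
  proof -
    interpret q: nondegenerate_form "tangent_space A q" "g q" by (rule form_at)
    show ?thesis
      using metric_compatible[OF W Z Z, of q]
        q.G_sym[OF vector_fieldD(1)[OF Z] vector_fieldD(1)[OF D_closed[OF W Z]]] by simp
  qed
  \<comment> \<open>The last term is symmetric in \<open>W\<close> and \<open>W'\<close> and cancels in the commutator.\<close>
  have d2: "W p (\<lambda>q. W' q ?h) = 2 * (g p (D W (D W' Z) p) (Z p) + g p (D W' Z p) (D W Z p))"
    if W: "W \<in> vector_fields A" and W': "W' \<in> vector_fields A" for W W'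
  proof -
    have "W p (\<lambda>q. W' q ?h) = W p (\<lambda>q. 2 * g q (D W' Z q) (Z q))"
      by (simp only: d1[OF W'])
    also have "\<dots> = 2 * W p (\<lambda>q. g q (D W' Z q) (Z q))"
      by (rule tangent_cmult[OF vector_fieldD(1)[OF W] smooth_metric[OF D_closed[OF W' Z] Z]])
    also have "\<dots> = 2 * (g p (D W (D W' Z) p) (Z p) + g p (D W' Z p) (D W Z p))"
      by (simp only: metric_compatible[OF W D_closed[OF W' Z] Z])
    finally show ?thesis .
  qed
  have "2 * g p (D (lie_bracket X Y) Z p) (Z p) = lie_bracket X Y p ?h"
    by (rule d1[OF lie_bracket_closed[OF X Y], symmetric])
  also have "\<dots> = X p (\<lambda>q. Y q ?h) - Y p (\<lambda>q. X q ?h)"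
    by (simp only: lie_bracket_def)
  also have "\<dots> = 2 * (g p (D X (D Y Z) p) (Z p) - g p (D Y (D X Z) p) (Z p))"
    unfolding d2[OF X Y] d2[OF Y X]
    using G_sym[OF vector_fieldD(1)[OF D_closed[OF X Z]] vector_fieldD(1)[OF D_closed[OF Y Z]]] by simp
  finally have "g p (D (lie_bracket X Y) Z p) (Z p) = g p (D X (D Y Z) p) (Z p) - g p (D Y (D X Z) p) (Z p)"
    by simp
  then show ?thesis
    using vector_fieldD(1)[OF Z, of p] vector_fieldD(1)[OF D_closed[OF X D_closed[OF Y Z]], of p]
      vector_fieldD(1)[OF D_closed[OF Y D_closed[OF X Z]], of p]
      vector_fieldD(1)[OF D_closed[OF lie_bracket_closed[OF X Y] Z], of p]
    by (simp add: curvature_def G_left V_closed)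
qed

lemma Jacobi:
  assumes X: "X \<in> vector_fields A" and Y: "Y \<in> vector_fields A" and Z: "Z \<in> vector_fields A"
  shows "lie_bracket X (lie_bracket Y Z) p + lie_bracket Y (lie_bracket Z X) p
    + lie_bracket Z (lie_bracket X Y) p = 0"
proof
  fix f
  show "(lie_bracket X (lie_bracket Y Z) p + lie_bracket Y (lie_bracket Z X) p
    + lie_bracket Z (lie_bracket X Y) p) f = 0 f"
  proof (cases "f \<in> smooth_functions A")
    case True
    have s: "(\<lambda>q. V q (\<lambda>r. W r f)) \<in> smooth_functions A"
      if "V \<in> vector_fields A" "W \<in> vector_fields A" for V W
      by (rule vector_fieldD(2)[OF that(1) vector_fieldD(2)[OF that(2) True]])
    have "lie_bracket U (lie_bracket V W) p f
        = U p (\<lambda>q. V q (\<lambda>r. W r f)) - U p (\<lambda>q. W q (\<lambda>r. V r f))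
          - (V p (\<lambda>q. W q (\<lambda>r. U r f)) - W p (\<lambda>q. V q (\<lambda>r. U r f)))"
      if "U \<in> vector_fields A" "V \<in> vector_fields A" "W \<in> vector_fields A" for U V W
      unfolding lie_bracket_def
      by (simp only: tangent_diff[OF vector_fieldD(1)[OF that(1)] s[OF that(2,3)] s[OF that(3,2)]])
    then show ?thesis
      using X Y Z by simp
  next
    case False
    have "lie_bracket U (lie_bracket V W) p f = 0"
      if "U \<in> vector_fields A" "V \<in> vector_fields A" "W \<in> vector_fields A" for U V W
      by (rule tangent_not_smooth[OF vector_fieldD(1) False])
        (intro lie_bracket_closed that)
    then show ?thesis using X Y Z by simp
  qed
qed

text \<open>As the torsion vanishes, the cyclic sum of the curvature is the cyclic sum of iterated brackets.\<close>

lemma curvature_Bianchi: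
  assumes X: "X \<in> vector_fields A" and Y: "Y \<in> vector_fields A" and Z: "Z \<in> vector_fields A"
  shows "curvature D X Y Z p + curvature D Y Z X p + curvature D Z X Y p = 0"
proof -
  have nested: "lie_bracket U (lie_bracket V W) p = D U (D V W) p - D U (D W V) p - D (lie_bracket V W) U p"
    if UVW: "U \<in> vector_fields A" "V \<in> vector_fields A" "W \<in> vector_fields A" for U V W
  proof -
    have "lie_bracket U (lie_bracket V W) = D U (lie_bracket V W) - D (lie_bracket V W) U"
      by (rule lie_bracket_eq[OF UVW(1) lie_bracket_closed[OF UVW(2,3)]])
    moreover have "D U (lie_bracket V W) = D U (D V W) - D U (D W V)"
      by (simp only: lie_bracket_eq UVW D_diff_right D_closed)
    ultimately show ?thesis by (simp only: fun_diff_def)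
  qed
  have "curvature D X Y Z p + curvature D Y Z X p + curvature D Z X Y p =
    lie_bracket X (lie_bracket Y Z) p + lie_bracket Y (lie_bracket Z X) p + lie_bracket Z (lie_bracket X Y) p"
    unfolding nested[OF X Y Z] nested[OF Y Z X] nested[OF Z X Y]
    by (simp add: curvature_def)
  then show ?thesis by (simp only: Jacobi[OF X Y Z])
qed

text \<open>The identities for vector fields are transferred to tangent vectors by extending the latter, with
  constant functions as coefficients.\<close>

lemma curvature_like_at: "curvature_like (tangent_space A p) (g p) (curvature_at A D p)"
proof -
  let ?V = "tangent_space A p" and ?R = "curvature_at A D p"
  interpret nondegenerate_form ?V "g p" by (rule form_at)
  let ?X = "extend_vec A p"
  have R_at: "?R x y z = curvature D (?X x) (?X y) (?X z) p" for x y z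
    by (rule curvature_at_def)
  have comb: "(scale_field (\<lambda>q. a) (?X x) + scale_field (\<lambda>q. b) (?X y)) p = a *\<^sub>R x + b *\<^sub>R y"
    "scale_field (\<lambda>q. a) (?X x) + scale_field (\<lambda>q. b) (?X y) \<in> vector_fields A"
    if "x \<in> ?V" "y \<in> ?V" for a b x y
    using extend_vec[OF that(1)] extend_vec[OF that(2)]
    by (simp_all only: plus_fun_apply scale_field_at vector_field_add vector_field_scale smooth_const)
  have closed: "?R x y z \<in> ?V" if "x \<in> ?V" "y \<in> ?V" "z \<in> ?V" for x y z
    unfolding R_at by (rule vector_fieldD(1)[OF curvature_closed]) (intro extend_vec that)+
  have skew0: "g p (?R x y z) z = 0" if "x \<in> ?V" "y \<in> ?V" "z \<in> ?V" for x y z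
    using curvature_skew_same[OF extend_vec(1)[OF that(1)] extend_vec(1)[OF that(2)] extend_vec(1)[OF that(3)], of p]
    unfolding R_at extend_vec(2)[OF that(3)] .
  have lin3: "linear_map_on ?V (?R x y)" if x: "x \<in> ?V" and y: "y \<in> ?V" for x y
    unfolding linear_map_on_def
  proof (intro ballI allI)
    fix z w a b assume z: "z \<in> ?V" and w: "w \<in> ?V"
    note e = extend_vec(1)[OF x] extend_vec(1)[OF y] extend_vec(1)[OF z] extend_vec(1)[OF w]
    have "?R x y (a *\<^sub>R z + b *\<^sub>R w)
        = curvature D (?X x) (?X y) (scale_field (\<lambda>q. a) (?X z) + scale_field (\<lambda>q. b) (?X w)) p"
      by (simp only: curvature_eq_at[OF e(1) e(2) comb(2)[OF z w]] comb(1)[OF z w] extend_vec(2)[OF x] extend_vec(2)[OF y])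
    also have "\<dots> = a *\<^sub>R ?R x y z + b *\<^sub>R ?R x y w"
      by (simp only: curvature_add_3 curvature_scale_3 vector_field_scale smooth_const e R_at plus_fun_apply scale_field_at)
    finally show "?R x y (a *\<^sub>R z + b *\<^sub>R w) = a *\<^sub>R ?R x y z + b *\<^sub>R ?R x y w" .
  qed
  show ?thesis
  proof
    fix x y z assume x: "x \<in> ?V" and y: "y \<in> ?V" and z: "z \<in> ?V"
    note e = extend_vec(1)[OF x] extend_vec(1)[OF y] extend_vec(1)[OF z]
    show "?R x y z \<in> ?V" by (rule closed[OF x y z])
    show "?R x y z = - ?R y x z"
      unfolding R_at curvature_antisym[OF e] fun_Compl_def by (rule refl)
    show "?R x y z + ?R y z x + ?R z x y = 0"
      unfolding R_at by (rule curvature_Bianchi[OF e])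
    fix w assume w: "w \<in> ?V"
    have "g p (?R x y (z + w)) (z + w) = 0" by (rule skew0[OF x y V_closed(1)[OF z w]])
    moreover have "?R x y (z + w) = ?R x y z + ?R x y w"
      by (rule linear_map_on_add[OF lin3[OF x y] V z w])
    ultimately show "g p (?R x y z) w = - g p (?R x y w) z"
      using skew0[OF x y z] skew0[OF x y w] closed[OF x y z] closed[OF x y w] z w
      by (simp add: G_left G_right V_closed)
  next
    fix x y assume x: "x \<in> ?V" and y: "y \<in> ?V"
    show "linear_map_on ?V (?R x y)" by (rule lin3[OF x y])
  next
    fix y z assume y: "y \<in> ?V" and z: "z \<in> ?V"
    show "linear_map_on ?V (\<lambda>x. ?R x y z)"
      unfolding linear_map_on_def
    proof (intro ballI allI)
      fix x w a b assume x: "x \<in> ?V" and w: "w \<in> ?V"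
      note e = extend_vec(1)[OF x] extend_vec(1)[OF y] extend_vec(1)[OF z] extend_vec(1)[OF w]
      have "?R (a *\<^sub>R x + b *\<^sub>R w) y z
          = curvature D (scale_field (\<lambda>q. a) (?X x) + scale_field (\<lambda>q. b) (?X w)) (?X y) (?X z) p"
        by (simp only: curvature_eq_at[OF comb(2)[OF x w] e(2,3)] comb(1)[OF x w] extend_vec(2)[OF y] extend_vec(2)[OF z])
      also have "\<dots> = a *\<^sub>R ?R x y z + b *\<^sub>R ?R w y z"
        by (simp only: curvature_add_1 curvature_scale_1 vector_field_scale smooth_const e R_at plus_fun_apply scale_field_at)
      finally show "?R (a *\<^sub>R x + b *\<^sub>R w) y z = a *\<^sub>R ?R x y z + b *\<^sub>R ?R w y z" .
    qed
  qed
qed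

lemma scalar_curvature_eq_sum:
  assumes E: "nondegenerate_form.orthogonal_basis (tangent_space A p) (g p) E"
  shows "scalar_curvature A g D p
    = (\<Sum>e\<in>E. (\<Sum>f\<in>E. g p (curvature_at A D p f e e) f / g p f f) / g p e e)"
proof -
  let ?V = "tangent_space A p" and ?R = "curvature_at A D p" and ?S = "ricci_tensor A D p"
  interpret curvature_like ?V "g p" ?R by (rule curvature_like_at)
  have EV: "f \<in> ?V" if "f \<in> E" for f using orthogonal_basisD(5)[OF E that] .
  have ricci: "?S y z = (\<Sum>f\<in>E. g p (?R f y z) f / g p f f)" if "y \<in> ?V" "z \<in> ?V" for y z
    unfolding ricci_tensor_def
    by (rule trace_on_orthogonal_basis[OF E T_linear1[OF that] T_closed[OF _ that]])
  have sums: "(\<Sum>f\<in>E. (a * u f + b * v f) / h f) = a *\<^sub>R (\<Sum>f\<in>E. u f / h f) + b *\<^sub>R (\<Sum>f\<in>E. v f / h f)"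
    for a b and u v h :: "'m tvec \<Rightarrow> real"
    by (simp add: add_divide_distrib sum.distrib sum_distrib_left)
  have lin2: "linear_map_on ?V (?S y)" if y: "y \<in> ?V" for y
    unfolding linear_map_on_def
  proof (intro ballI allI)
    fix z w a b assume z: "z \<in> ?V" and w: "w \<in> ?V"
    have "g p (?R f y (a *\<^sub>R z + b *\<^sub>R w)) f = a * g p (?R f y z) f + b * g p (?R f y w) f" if "f \<in> E" for f
      using EV[OF that] y z w T_linear3[of f y] by (simp add: linear_map_on_def G_left V_closed T_closed)
    then show "?S y (a *\<^sub>R z + b *\<^sub>R w) = a *\<^sub>R ?S y z + b *\<^sub>R ?S y w"
      unfolding ricci[OF y z] ricci[OF y w] ricci[OF y V_closed(1)[OF V_closed(3)[OF z] V_closed(3)[OF w]]]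
      by (subst sums[symmetric]) (intro sum.cong refl, simp only:)
  qed
  have lin1: "linear_map_on ?V (\<lambda>y. ?S y z)" if z: "z \<in> ?V" for z
    unfolding linear_map_on_def
  proof (intro ballI allI)
    fix y w a b assume y: "y \<in> ?V" and w: "w \<in> ?V"
    have "g p (?R f (a *\<^sub>R y + b *\<^sub>R w) z) f = a * g p (?R f y z) f + b * g p (?R f w z) f" if "f \<in> E" for f
      using EV[OF that] y z w T_linear2[of f z] by (simp add: linear_map_on_def G_left V_closed T_closed)
    then show "?S (a *\<^sub>R y + b *\<^sub>R w) z = a *\<^sub>R ?S y z + b *\<^sub>R ?S w z"
      unfolding ricci[OF y z] ricci[OF w z] ricci[OF V_closed(1)[OF V_closed(3)[OF y] V_closed(3)[OF w]] z]
      by (subst sums[symmetric]) (intro sum.cong refl, simp only:)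
  qed
  have "scalar_curvature A g D p = (\<Sum>e\<in>E. ?S e e / g p e e)"
    unfolding scalar_curvature_def ricci_operator_def
    by (rule trace_on_raised_form[OF E lin1 lin2])
  also have "\<dots> = (\<Sum>e\<in>E. (\<Sum>f\<in>E. g p (?R f e e) f / g p f f) / g p e e)"
    by (intro sum.cong refl) (simp only: ricci EV)
  finally show ?thesis .
qed

end

section \<open>Para-Sasakian manifolds\<close>

sublocale eps_para_sasakian_manifold \<subseteq> semi_riemannian_manifold A g D
  by unfold_locales (rule metric, rule levi_civita)

context eps_para_sasakian_manifold
begin

lemma eps_square: "\<epsilon> * \<epsilon> = 1" "\<epsilon> \<noteq> 0"
  using eps by auto

lemma phi_closed: "v \<in> tangent_space A p \<Longrightarrow> \<phi> p v \<in> tangent_space A p"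
  using phi_tensor by (auto simp: endo_field_def)

lemma phi_linear: "linear_map_on (tangent_space A p) (\<phi> p)"
  using phi_tensor by (simp add: endo_field_def)

lemma apply_phi_closed: "X \<in> vector_fields A \<Longrightarrow> apply_endo \<phi> X \<in> vector_fields A"
  using phi_tensor by (simp add: endo_field_def)

lemma xi_tangent: "\<xi> p \<in> tangent_space A p"
  by (rule vector_fieldD(1)[OF xi_field])

text \<open>Compatibility of \<open>g\<close> with \<open>\<phi>\<close> for the pair \<open>(v, \<xi>)\<close>, where \<open>\<phi> \<xi> = 0\<close>.\<close>

lemma metric_xi:
  assumes v: "v \<in> tangent_space A p"
  shows "g p v (\<xi> p) = \<epsilon> * \<eta> p v"
proof -
  interpret nondegenerate_form "tangent_space A p" "g p" by (rule form_at)
  have "g p (\<phi> p v) (\<phi> p (\<xi> p)) = g p v (\<xi> p) - \<epsilon> * \<eta> p v * \<eta> p (\<xi> p)"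
    using metric_phi[OF extend_vec(1)[OF v] xi_field, of p] by (simp only: extend_vec(2)[OF v])
  moreover have "g p (\<phi> p v) (\<phi> p (\<xi> p)) = 0"
    unfolding phi_xi by (rule G_right(5)[OF phi_closed[OF v]])
  ultimately show ?thesis by (simp add: eta_xi)
qed

lemma metric_xi_xi: "g p (\<xi> p) (\<xi> p) = \<epsilon>"
  using metric_xi[OF xi_tangent] by (simp add: eta_xi)

lemma D_zero_right: "X \<in> vector_fields A \<Longrightarrow> D X 0 = 0"
  using D_add_right[OF _ vector_field_zero vector_field_zero, of X] by (simp only: add_0_right add_cancel_right_right)

text \<open>The identity for \<open>\<nabla>\<phi>\<close> with \<open>Y = \<xi>\<close> gives \<open>\<phi>(\<nabla>\<^sub>X \<xi>) = \<epsilon> \<phi>\<^sup>2 X\<close>. Applying \<open>\<phi>\<close> once more recovers \<open>\<nabla>\<^sub>X \<xi>\<close>,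
  because \<open>g(\<xi>,\<xi>)\<close> is constant and so \<open>\<eta>(\<nabla>\<^sub>X \<xi>) = 0\<close>.\<close>

lemma D_xi:
  assumes X: "X \<in> vector_fields A"
  shows "D X \<xi> = scale_field (\<lambda>q. \<epsilon>) (apply_endo \<phi> X)"
proof
  fix p
  interpret nondegenerate_form "tangent_space A p" "g p" by (rule form_at)
  let ?V = "tangent_space A p" and ?w = "D X \<xi> p" and ?x = "X p"
  have x: "?x \<in> ?V" by (rule vector_fieldD(1)[OF X])
  have w: "?w \<in> ?V" by (rule vector_fieldD(1)[OF D_closed[OF X xi_field]])
  have px: "\<phi> p ?x \<in> ?V" and ppx: "\<phi> p (\<phi> p ?x) \<in> ?V" by (intro phi_closed x)+
  have phi0: "apply_endo \<phi> \<xi> = 0"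
    by (simp add: apply_endo_def phi_xi fun_eq_iff)
  have "X p (\<lambda>q. g q (\<xi> q) (\<xi> q)) = 0"
    unfolding metric_xi_xi by (rule tangent_const[OF x])
  then have "g p ?w (\<xi> p) + g p (\<xi> p) ?w = 0"
    by (simp only: metric_compatible[OF X xi_field xi_field])
  then have "g p ?w (\<xi> p) = 0"
    using G_sym[OF xi_tangent w] by simp
  then have eta_w: "\<eta> p ?w = 0"
    using metric_xi[OF w] eps_square by simp
  have "cov_deriv_endo D \<phi> X \<xi> p = - \<phi> p ?w"
    unfolding cov_deriv_endo_def phi0 D_zero_right[OF X] by (simp add: apply_endo_def)
  moreover have "cov_deriv_endo D \<phi> X \<xi> p = - (\<epsilon> *\<^sub>R \<phi> p (\<phi> p ?x))"
    unfolding para_sasakian[OF X xi_field] phi_xi eta_xi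
    by (simp only: G_right(5)[OF px] scaleR_zero_left mult_1_right) (simp only: minus_zero diff_0)
  ultimately have "\<phi> p ?w = \<epsilon> *\<^sub>R \<phi> p (\<phi> p ?x)"
    by (simp only: neg_equal_iff_equal)
  then have "\<phi> p (\<phi> p ?w) = \<epsilon> *\<^sub>R \<phi> p (\<phi> p (\<phi> p ?x))"
    by (simp only: linear_map_on_scale[OF phi_linear V ppx])
  then show "?w = scale_field (\<lambda>q. \<epsilon>) (apply_endo \<phi> X) p"
    by (simp only: phi_square[OF w] phi_square[OF px] eta_w eta_phi[OF x] scale_field_at apply_endo_def
        scaleR_zero_left diff_0_right)
qed

text \<open>Inserting \<open>\<nabla>\<xi> = \<epsilon> \<phi>\<close> leaves \<open>\<epsilon> ((\<nabla>\<^sub>X \<phi>)Y - (\<nabla>\<^sub>Y \<phi>)X)\<close>, in which the terms with the metric cancel by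
  symmetry.\<close>

lemma curvature_xi:
  assumes x: "x \<in> tangent_space A p" and y: "y \<in> tangent_space A p"
  shows "curvature_at A D p x y (\<xi> p) = \<eta> p x *\<^sub>R y - \<eta> p y *\<^sub>R x"
proof -
  interpret nondegenerate_form "tangent_space A p" "g p" by (rule form_at)
  let ?V = "tangent_space A p" and ?X = "extend_vec A p x" and ?Y = "extend_vec A p y"
  have X: "?X \<in> vector_fields A" "?X p = x" and Y: "?Y \<in> vector_fields A" "?Y p = y"
    by (simp_all only: extend_vec x y)
  have phi: "\<phi> p x \<in> ?V" "\<phi> p y \<in> ?V" "\<phi> p (\<phi> p x) \<in> ?V" "\<phi> p (\<phi> p y) \<in> ?V"
    by (intro phi_closed x y)+
  have D_phi: "D U (scale_field (\<lambda>q. \<epsilon>) (apply_endo \<phi> W)) p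
      = \<epsilon> *\<^sub>R (cov_deriv_endo D \<phi> U W p + \<phi> p (D U W p))"
    if U: "U \<in> vector_fields A" and W: "W \<in> vector_fields A" for U W
  proof -
    have "D U (scale_field (\<lambda>q. \<epsilon>) (apply_endo \<phi> W)) p = U p (\<lambda>q. \<epsilon>) *\<^sub>R apply_endo \<phi> W p + \<epsilon> *\<^sub>R D U (apply_endo \<phi> W) p"
      by (simp only: D_scale_right[OF U apply_phi_closed[OF W] smooth_const] plus_fun_apply scale_field_at)
    also have "\<dots> = \<epsilon> *\<^sub>R D U (apply_endo \<phi> W) p"
      by (simp only: tangent_const[OF vector_fieldD(1)[OF U]] scaleR_zero_left add_0_left)
    also have "D U (apply_endo \<phi> W) p = cov_deriv_endo D \<phi> U W p + \<phi> p (D U W p)"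
      by (simp add: cov_deriv_endo_def apply_endo_def)
    finally show ?thesis .
  qed
  have DXY: "D ?X ?Y p \<in> ?V" "D ?Y ?X p \<in> ?V"
    by (intro vector_fieldD(1)[OF D_closed] X Y)+
  have bracket: "\<phi> p (lie_bracket ?X ?Y p) = \<phi> p (D ?X ?Y p) - \<phi> p (D ?Y ?X p)"
    by (simp only: lie_bracket_eq[OF X(1) Y(1)] minus_apply linear_map_on_diff[OF phi_linear V DXY])
  have "curvature_at A D p x y (\<xi> p) = curvature D ?X ?Y \<xi> p"
    by (simp only: curvature_eq_at[OF X(1) Y(1) xi_field] X Y)
  also have "\<dots> = D ?X (D ?Y \<xi>) p - D ?Y (D ?X \<xi>) p - D (lie_bracket ?X ?Y) \<xi> p"
    by (simp only: curvature_def minus_apply)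
  also have "\<dots> = \<epsilon> *\<^sub>R (cov_deriv_endo D \<phi> ?X ?Y p + \<phi> p (D ?X ?Y p))
      - \<epsilon> *\<^sub>R (cov_deriv_endo D \<phi> ?Y ?X p + \<phi> p (D ?Y ?X p))
      - \<epsilon> *\<^sub>R (\<phi> p (D ?X ?Y p) - \<phi> p (D ?Y ?X p))"
    by (simp only: D_xi X Y lie_bracket_closed D_phi) (simp only: scale_field_at apply_endo_def bracket)
  also have "\<dots> = \<epsilon> *\<^sub>R (cov_deriv_endo D \<phi> ?X ?Y p - cov_deriv_endo D \<phi> ?Y ?X p)"
    by (simp only: scaleR_add_right scaleR_diff_right) (simp only: algebra_simps)
  also have "cov_deriv_endo D \<phi> ?X ?Y p - cov_deriv_endo D \<phi> ?Y ?X p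
      = (\<epsilon> * \<eta> p x) *\<^sub>R \<phi> p (\<phi> p y) - (\<epsilon> * \<eta> p y) *\<^sub>R \<phi> p (\<phi> p x)"
    unfolding para_sasakian[OF X(1) Y(1)] para_sasakian[OF Y(1) X(1)] X(2) Y(2) G_sym[OF phi(2,1)]
    by (simp only: algebra_simps)
  also have "\<epsilon> *\<^sub>R \<dots> = \<eta> p x *\<^sub>R (y - \<eta> p y *\<^sub>R \<xi> p) - \<eta> p y *\<^sub>R (x - \<eta> p x *\<^sub>R \<xi> p)"
    by (simp only: scaleR_diff_right[of \<epsilon>] scaleR_scaleR mult.assoc[symmetric] eps_square mult_1_left
        phi_square[OF x] phi_square[OF y])
  also have "\<dots> = \<eta> p x *\<^sub>R y - \<eta> p y *\<^sub>R x"
    by (simp only: scaleR_diff_right scaleR_scaleR mult.commute[of "\<eta> p y" "\<eta> p x"]) (simp only: algebra_simps)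
  finally show ?thesis .
qed

text \<open>Orthogonality to \<open>\<xi>\<close> means lying in the kernel of \<open>\<eta>\<close>, as \<open>g(v,\<xi>) = \<epsilon> \<eta>(v)\<close>.\<close>

lemma adapted_orthogonal_basis:
  assumes dim: "DIM('e) = 3"
  obtains a b where
    "nondegenerate_form.orthogonal_basis (tangent_space A p) (g p) {\<xi> p, a, b}"
    "\<xi> p \<noteq> a" "\<xi> p \<noteq> b" "a \<noteq> b"
    "a \<in> tangent_space A p" "b \<in> tangent_space A p" "\<eta> p a = 0" "\<eta> p b = 0"
    "g p a a \<noteq> 0" "g p b b \<noteq> 0" "g p a b = 0"
proof -
  let ?V = "tangent_space A p"
  interpret nondegenerate_form ?V "g p" by (rule form_at)
  have d: "dim ?V = 3" by (simp only: dim_tangent_space dim)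
  have s1: "orthogonal_system {\<xi> p}"
    using xi_tangent metric_xi_xi eps_square by (simp add: orthogonal_system_def)
  have eta0: "\<eta> p v = 0" if "v \<in> ?V" "g p v (\<xi> p) = 0" for v
    using metric_xi[OF that(1)] that(2) eps_square by simp
  obtain a where a: "a \<in> ?V" "g p a (\<xi> p) = 0" "g p a a \<noteq> 0" "a \<noteq> \<xi> p" "orthogonal_system {a, \<xi> p}"
    by (rule orthogonal_system_extend[OF s1]) (simp_all add: d)
  have card: "card {a, \<xi> p} < dim ?V" using a(4) by (simp add: d)
  obtain b where b: "b \<in> ?V" "\<And>e. e \<in> {a, \<xi> p} \<Longrightarrow> g p b e = 0" "g p b b \<noteq> 0"
      "b \<notin> {a, \<xi> p}" "orthogonal_system (insert b {a, \<xi> p})"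
    by (rule orthogonal_system_extend[OF a(5) card], rule that; simp)
  have set: "insert b {a, \<xi> p} = {\<xi> p, a, b}" by blast
  have ba: "g p b a = 0" "g p b (\<xi> p) = 0" using b(2) by simp_all
  have distinct: "\<xi> p \<noteq> a" "\<xi> p \<noteq> b" "a \<noteq> b" using a(4) b(4) by auto
  then have "orthogonal_basis {\<xi> p, a, b}"
    using b(5) by (simp add: orthogonal_basis_def d set)
  then show thesis
    using distinct a(1) b(1) eta0[OF a(1,2)] eta0[OF b(1) ba(2)] a(3) b(3) ba(1) G_sym[OF b(1) a(1)]
    by (intro that[of a b]) simp_all
qed

text \<open>Each of the four ordered pairs that contain \<open>\<xi>\<close> contributes \<open>-1/\<epsilon> = -\<epsilon>\<close>, and the two orders of
  \<open>(a,b)\<close> contribute the same sectional term.\<close>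

lemma scalar_curvature_sectional:
  assumes E: "nondegenerate_form.orthogonal_basis (tangent_space A p) (g p) {\<xi> p, a, b}"
    and distinct: "\<xi> p \<noteq> a" "\<xi> p \<noteq> b" "a \<noteq> b"
    and a: "a \<in> tangent_space A p" "\<eta> p a = 0" "g p a a \<noteq> 0"
    and b: "b \<in> tangent_space A p" "\<eta> p b = 0" "g p b b \<noteq> 0"
  shows "scalar_curvature A g D p
    = 2 * (g p (curvature_at A D p a b b) a / (g p a a * g p b b)) - 4 * \<epsilon>"
proof -
  let ?V = "tangent_space A p" and ?R = "curvature_at A D p" and ?u = "\<xi> p"
  interpret curvature_like ?V "g p" ?R by (rule curvature_like_at)
  note u = xi_tangent[of p]
  have xi_part: "g p (?R ?u v v) ?u = - g p v v" "g p (?R v ?u ?u) v = - g p v v"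
    if v: "v \<in> ?V" "\<eta> p v = 0" for v
  proof -
    have "?R ?u v ?u = v" using curvature_xi[OF u v(1)] v(2) by (simp add: eta_xi)
    then show "g p (?R ?u v v) ?u = - g p v v" using T_skew[OF u v(1) v(1) u] by simp
    have "?R v ?u ?u = - v" using curvature_xi[OF v(1) u] v(2) by (simp add: eta_xi)
    then show "g p (?R v ?u ?u) v = - g p v v" using G_left(4)[OF v(1) v(1)] by simp
  qed
  have sym: "g p (?R b a a) b = g p (?R a b b) a"
    using T_antisym[OF b(1) a(1) a(1)] T_skew[OF a(1) b(1) a(1) b(1)] G_left(4)[OF b(1) T_closed[OF a(1) b(1) a(1)]]
    by simp
  have diag: "g p (?R v v v) v = 0" if "v \<in> ?V" for v
    using T_same[OF that that] G_left(5)[OF that] by simp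
  have inv: "1 / \<epsilon> = \<epsilon>" using eps by auto
  have "scalar_curvature A g D p =
      (\<Sum>e\<in>{?u, a, b}. (\<Sum>f\<in>{?u, a, b}. g p (?R f e e) f / g p f f) / g p e e)"
    by (rule scalar_curvature_eq_sum[OF E])
  also have "\<dots> = - 1 / \<epsilon> + - 1 / \<epsilon> + (- 1 / \<epsilon> + - 1 / \<epsilon>)
      + 2 * (g p (?R a b b) a / (g p a a * g p b b))"
    using distinct a(3) b(3) eps_square(2)
    by (simp add: diag u a b xi_part metric_xi_xi sym field_simps)
  also have "- 1 / \<epsilon> = - \<epsilon>" using inv by simp
  finally show ?thesis by simp
qed

text \<open>The tensor \<open>?T\<close> below is the difference between the curvature and the model tensor of constant
  curvature \<open>-\<epsilon>\<close>.\<close>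

lemma pointwise_constant_curvature:
  assumes dim: "DIM('e) = 3" and r: "scalar_curvature A g D p = - 6 * \<epsilon>"
    and xyz: "x \<in> tangent_space A p" "y \<in> tangent_space A p" "z \<in> tangent_space A p"
  shows "curvature_at A D p x y z = (- \<epsilon>) *\<^sub>R (g p y z *\<^sub>R x - g p x z *\<^sub>R y)"
proof -
  let ?V = "tangent_space A p" and ?R = "curvature_at A D p"
  obtain a b where E: "nondegenerate_form.orthogonal_basis ?V (g p) {\<xi> p, a, b}"
    and distinct: "\<xi> p \<noteq> a" "\<xi> p \<noteq> b" "a \<noteq> b"
    and a: "a \<in> ?V" and b: "b \<in> ?V" and ea: "\<eta> p a = 0" and eb: "\<eta> p b = 0"
    and na: "g p a a \<noteq> 0" and nb: "g p b b \<noteq> 0" and ab: "g p a b = 0"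
    by (rule adapted_orthogonal_basis[OF dim])
  interpret R: curvature_like ?V "g p" ?R by (rule curvature_like_at)
  let ?T = "\<lambda>x y z. ?R x y z + \<epsilon> *\<^sub>R (g p y z *\<^sub>R x - g p x z *\<^sub>R y)"
  interpret T: curvature_like ?V "g p" ?T
  proof
    fix x y z assume x: "x \<in> ?V" and y: "y \<in> ?V" and z: "z \<in> ?V"
    show "?T x y z \<in> ?V" by (intro R.V_closed R.T_closed x y z)
    show "?T x y z = - ?T y x z"
      unfolding R.T_antisym[OF x y z] by (simp add: algebra_simps)
    show "?T x y z + ?T y z x + ?T z x y = 0"
    proof -
      have "?T x y z + ?T y z x + ?T z x y = (?R x y z + ?R y z x + ?R z x y)"
        unfolding R.G_sym[OF z x] R.G_sym[OF y x] R.G_sym[OF z y] by (simp add: algebra_simps)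
      then show ?thesis by (simp only: R.T_Bianchi[OF x y z])
    qed
    fix w assume w: "w \<in> ?V"
    have eq: "g p (?T x y z) w = g p (?R x y z) w + \<epsilon> * (g p y z * g p x w - g p x z * g p y w)"
      if "z \<in> ?V" "w \<in> ?V" for z w
      using that x y R.T_closed[OF x y that(1)] by (simp add: R.G_left R.V_closed)
    show "g p (?T x y z) w = - g p (?T x y w) z"
      unfolding eq[OF z w] eq[OF w z] R.T_skew[OF x y z w] by (simp add: algebra_simps)
  next
    fix y z assume y: "y \<in> ?V" and z: "z \<in> ?V"
    show "linear_map_on ?V (\<lambda>x. ?T x y z)"
      unfolding linear_map_on_def
    proof (intro ballI allI)
      fix x w s t assume x: "x \<in> ?V" and w: "w \<in> ?V"
      have "?R (s *\<^sub>R x + t *\<^sub>R w) y z = s *\<^sub>R ?R x y z + t *\<^sub>R ?R w y z"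
        using R.T_linear1[OF y z] x w by (simp add: linear_map_on_def)
      moreover have "g p (s *\<^sub>R x + t *\<^sub>R w) z = s * g p x z + t * g p w z"
        using x w z by (simp add: R.G_left R.V_closed)
      ultimately show "?T (s *\<^sub>R x + t *\<^sub>R w) y z = s *\<^sub>R ?T x y z + t *\<^sub>R ?T w y z"
        by (simp add: algebra_simps)
    qed
  next
    fix x y assume x: "x \<in> ?V" and y: "y \<in> ?V"
    show "linear_map_on ?V (?T x y)"
      unfolding linear_map_on_def
    proof (intro ballI allI)
      fix z w s t assume z: "z \<in> ?V" and w: "w \<in> ?V"
      have "?R x y (s *\<^sub>R z + t *\<^sub>R w) = s *\<^sub>R ?R x y z + t *\<^sub>R ?R x y w"
        using R.T_linear3[OF x y] z w by (simp add: linear_map_on_def)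
      moreover have "g p v (s *\<^sub>R z + t *\<^sub>R w) = s * g p v z + t * g p v w" if "v \<in> ?V" for v
        using z w that by (simp add: R.G_right R.V_closed)
      ultimately show "?T x y (s *\<^sub>R z + t *\<^sub>R w) = s *\<^sub>R ?T x y z + t *\<^sub>R ?T x y w"
        using x y by (simp add: algebra_simps)
    qed
  qed
  \<comment> \<open>On \<open>\<xi>\<close> the model tensor of curvature \<open>-\<epsilon>\<close> agrees with the curvature, because \<open>g(v,\<xi>) = \<epsilon> \<eta>(v)\<close> and \<open>\<epsilon>\<^sup>2 = 1\<close>.\<close>
  have null: "?T v w (\<xi> p) = 0" if v: "v \<in> ?V" and w: "w \<in> ?V" for v w
  proof -
    have "?T v w (\<xi> p) = \<eta> p v *\<^sub>R w - \<eta> p w *\<^sub>R v + ((\<epsilon> * \<epsilon>) * \<eta> p w) *\<^sub>R v - ((\<epsilon> * \<epsilon>) * \<eta> p v) *\<^sub>R w"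
      unfolding curvature_xi[OF v w] metric_xi[OF v] metric_xi[OF w]
      by (simp only: scaleR_diff_right scaleR_scaleR mult.assoc add_diff_eq)
    then show ?thesis by (simp only: eps_square mult_1_left) simp
  qed
  have "g p (?R a b b) a / (g p a a * g p b b) = - \<epsilon>"
    using scalar_curvature_sectional[OF E distinct a ea na b eb nb] r by simp
  then have "g p (?R a b b) a = - \<epsilon> * (g p a a * g p b b)"
    using na nb by (simp add: divide_eq_eq)
  then have "g p (?T a b b) a = 0"
    using a b ab R.T_closed[OF a b b] by (simp add: R.G_left R.V_closed)
  then have "?T x y z = 0"
    by (intro T.curvature_zero_if_nullity_and_sectional_zero[OF E distinct null _ xyz])
  then show ?thesis
    unfolding scaleR_minus_left by (rule eq_neg_iff_add_eq_0[THEN iffD2])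
qed

text \<open>If the curvature is constant, evaluating \<open>R(a,\<xi>)\<xi>\<close> in two ways shows that the constant is \<open>-\<epsilon>\<close>.\<close>

lemma space_form_iff_scalar_curvature:
  assumes dim: "DIM('e) = 3"
  shows "indefinite_space_form A g D \<longleftrightarrow> (\<forall>p. scalar_curvature A g D p = - 6 * \<epsilon>)"
proof
  assume "indefinite_space_form A g D"
  then obtain c where c: "\<forall>X\<in>vector_fields A. \<forall>Y\<in>vector_fields A. \<forall>Z\<in>vector_fields A. \<forall>p.
       curvature D X Y Z p = c *\<^sub>R (g p (Y p) (Z p) *\<^sub>R X p - g p (X p) (Z p) *\<^sub>R Y p)"
    unfolding indefinite_space_form_def by (rule exE)
  show "\<forall>p. scalar_curvature A g D p = - 6 * \<epsilon>"
  proof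
    fix p
    let ?V = "tangent_space A p" and ?R = "curvature_at A D p"
    interpret curvature_like ?V "g p" ?R by (rule curvature_like_at)
    have R: "?R x y z = c *\<^sub>R (g p y z *\<^sub>R x - g p x z *\<^sub>R y)"
      if "x \<in> ?V" "y \<in> ?V" "z \<in> ?V" for x y z
      using c[rule_format, OF extend_vec(1)[OF that(1)] extend_vec(1)[OF that(2)] extend_vec(1)[OF that(3)], of p]
      by (simp only: curvature_at_def extend_vec(2)[OF that(1)] extend_vec(2)[OF that(2)] extend_vec(2)[OF that(3)])
    obtain a b where E: "orthogonal_basis {\<xi> p, a, b}"
      and distinct: "\<xi> p \<noteq> a" "\<xi> p \<noteq> b" "a \<noteq> b"
      and a: "a \<in> ?V" and b: "b \<in> ?V" and ea: "\<eta> p a = 0" and eb: "\<eta> p b = 0"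
      and na: "g p a a \<noteq> 0" and nb: "g p b b \<noteq> 0" and ab: "g p a b = 0"
      by (rule adapted_orthogonal_basis[OF dim])
    note u = xi_tangent[of p]
    have "g p (?R a (\<xi> p) (\<xi> p)) a = - g p a a"
      using curvature_xi[OF a u] ea G_left(4)[OF a a] by (simp add: eta_xi)
    moreover have "g p (?R a (\<xi> p) (\<xi> p)) a = c * \<epsilon> * g p a a"
      using R[OF a u u] metric_xi[OF a] ea a u by (simp add: metric_xi_xi G_left V_closed)
    ultimately have "(c * \<epsilon> + 1) * g p a a = 0" by (simp add: algebra_simps)
    then have "c * \<epsilon> = - 1" using na by (simp add: add_eq_0_iff2)
    then have "(c * \<epsilon>) * \<epsilon> = - \<epsilon>" by simp
    then have c_eq: "c = - \<epsilon>" by (simp only: mult.assoc eps_square mult_1_right)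
    have "g p (?R a b b) a = c * (g p a a * g p b b)"
      using R[OF a b b] ab a b by (simp add: G_left V_closed)
    then show "scalar_curvature A g D p = - 6 * \<epsilon>"
      using scalar_curvature_sectional[OF E distinct a ea na b eb nb] na nb c_eq by simp
  qed
next
  assume r: "\<forall>p. scalar_curvature A g D p = - 6 * \<epsilon>"
  show "indefinite_space_form A g D"
    unfolding indefinite_space_form_def
  proof (intro exI[of _ "- \<epsilon>"] ballI allI)
    fix X Y Z p assume XYZ: "X \<in> vector_fields A" "Y \<in> vector_fields A" "Z \<in> vector_fields A"
    show "curvature D X Y Z p = (- \<epsilon>) *\<^sub>R (g p (Y p) (Z p) *\<^sub>R X p - g p (X p) (Z p) *\<^sub>R Y p)"
      unfolding curvature_eq_at[OF XYZ]
      by (rule pointwise_constant_curvature[OF dim spec[OF r] vector_fieldD(1)[OF XYZ(1)]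
            vector_fieldD(1)[OF XYZ(2)] vector_fieldD(1)[OF XYZ(3)]])
  qed
qed

end

theorem lemma2p1:
  fixes A :: "('m::{t2_space, second_countable_topology}, real ^ 3) chart set"
    and \<phi> :: "'m \<Rightarrow> 'm tvec \<Rightarrow> 'm tvec"
    and \<xi> :: "'m vfield"
    and \<eta> :: "'m \<Rightarrow> 'm tvec \<Rightarrow> real"
    and g :: "'m \<Rightarrow> 'm tvec \<Rightarrow> 'm tvec \<Rightarrow> real"
    and \<epsilon> :: real
    and D :: "'m connection"
  assumes "eps_para_sasakian_manifold A \<phi> \<xi> \<eta> g \<epsilon> D"
  shows "indefinite_space_form A g D \<longleftrightarrow> (\<forall>p. scalar_curvature A g D p = - 6 * \<epsilon>)"
  by (rule eps_para_sasakian_manifold.space_form_iff_scalar_curvature[OF assms]) simp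

end
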